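(* Let $C>0$ be a constant and let $\triangle\in\{=,\neq,<,\leq,>,\geq\}$. The following problem is in $\mathsf{TC}^1$. Input: a power circuit $(\Pi,\delta_\Pi)$ with $\mathrm{depth}(\Pi)\leq C\cdot\log_2|\Pi|$ together with two markings $L,M$ on $\Pi$. Question: does $\varepsilon(L)\mathrel{\triangle}\varepsilon(M)$ hold?
   Context: Power circuits. Let $\Gamma$ be a finite set and $\delta\colon\Gamma\times\Gamma\to\{-1,0,1\}$ such that the directed graph on $\Gamma$ with edge set $\{(P,Q):\delta(P,Q)\neq 0\}$ is acyclic (a dag). A marking on $\Gamma$ is a map $M\colon\Gamma\to\{-1,0,1\}$. The successor marking of $P\in\Gamma$ is $\Lambda_P\colon Q\mapsto\delta(P,Q)$. The evaluation is defined bottom-up in the dag by $\varepsilon(P)=2^{\varepsilon(\Lambda_P)}$ for nodes and $\varepsilon(M)=\sum_{P}M(P)\varepsilon(P)$ for markings (the empty sum is $0$). $(\Gamma,\delta)$ is a power circuit if every node evaluates to an element of $\{2^n:n\in\mathbb{N}\}$. Its size is $|\Gamma|$ and $\mathrm{depth}(\Gamma)$ is the number of edges of a longest path in the dag. An integer is given by a power circuit as the evaluation of a marking on it. Encoding: a power circuit with $n$ nodes is given by the $n\times n$ matrix of $\delta$, a marking by a sequence of $n$ symbols from $\{-1,0,1\}$, each symbol encoded by two bits. $\mathsf{TC}^k$ is the (non-uniform) class of problems decided by families of polynomial-size circuits of depth $O(\log^k n)$ ($n$ the input length) with unbounded fan-in And, Or, Not and Majority gates. *)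

theory Defs
  imports Complex_Main "HOL-Library.FuncSet" "HOL-Library.Landau_Symbols"
begin

section \<open>Power circuits\<close>

definition marking :: "'a set \<Rightarrow> ('a \<Rightarrow> int) \<Rightarrow> bool" where
  "marking \<Gamma> M \<longleftrightarrow> M \<in> \<Gamma> \<rightarrow> {-1, 0, 1}"

definition dag_edges :: "'a set \<Rightarrow> ('a \<Rightarrow> 'a \<Rightarrow> int) \<Rightarrow> ('a \<times> 'a) set" where
  "dag_edges \<Gamma> \<delta> = {(P, Q). P \<in> \<Gamma> \<and> Q \<in> \<Gamma> \<and> \<delta> P Q \<noteq> 0}"

text \<open>The successor marking of a node \<open>P\<close> is \<open>\<delta> P\<close>. Nodes are evaluated by recursion along
  the edges; for non-successors \<open>Q\<close> of \<open>P\<close> the unspecified value that \<open>wfrec\<close> passes to the body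
  is multiplied by \<open>\<delta> P Q = 0\<close>, see \<open>node_eval_eq\<close> below. Values are real because arbitrary
  markings may evaluate to negative exponents.\<close>

definition node_eval :: "'a set \<Rightarrow> ('a \<Rightarrow> 'a \<Rightarrow> int) \<Rightarrow> 'a \<Rightarrow> real" where
  "node_eval \<Gamma> \<delta> = wfrec ((dag_edges \<Gamma> \<delta>)\<inverse>)
     (\<lambda>\<epsilon> P. 2 powr (\<Sum>Q\<in>\<Gamma>. real_of_int (\<delta> P Q) * \<epsilon> Q))"

definition marking_eval :: "'a set \<Rightarrow> ('a \<Rightarrow> 'a \<Rightarrow> int) \<Rightarrow> ('a \<Rightarrow> int) \<Rightarrow> real" where
  "marking_eval \<Gamma> \<delta> M = (\<Sum>P\<in>\<Gamma>. real_of_int (M P) * node_eval \<Gamma> \<delta> P)"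

lemma node_eval_eq:
  assumes "finite \<Gamma>" "acyclic (dag_edges \<Gamma> \<delta>)" "P \<in> \<Gamma>"
  shows "node_eval \<Gamma> \<delta> P = 2 powr marking_eval \<Gamma> \<delta> (\<delta> P)"
proof -
  have "finite (dag_edges \<Gamma> \<delta>)"
    by (rule finite_subset[of _ "\<Gamma> \<times> \<Gamma>"]) (use assms(1) in \<open>auto simp: dag_edges_def\<close>)
  then have wf: "wf ((dag_edges \<Gamma> \<delta>)\<inverse>)"
    using assms(2) by (rule finite_acyclic_wf_converse)
  show ?thesis
    unfolding marking_eval_def
    by (subst (1) node_eval_def, subst wfrec[OF wf], fold node_eval_def,
        intro arg_cong[where f = "\<lambda>x. 2 powr x"] sum.cong)
      (use assms(3) in \<open>auto simp: cut_def dag_edges_def\<close>)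
qed

definition power_circuit :: "'a set \<Rightarrow> ('a \<Rightarrow> 'a \<Rightarrow> int) \<Rightarrow> bool" where
  "power_circuit \<Gamma> \<delta> \<longleftrightarrow>
     finite \<Gamma> \<and> (\<forall>P\<in>\<Gamma>. marking \<Gamma> (\<delta> P)) \<and> acyclic (dag_edges \<Gamma> \<delta>) \<and>
     (\<forall>P\<in>\<Gamma>. \<exists>n::nat. node_eval \<Gamma> \<delta> P = 2 ^ n)"

text \<open>In an acyclic graph every walk is a path, so the length of a longest path is the largest
  \<open>k\<close> for which there is a walk with \<open>k\<close> edges. The value is \<open>0\<close> if there are no edges.\<close>

definition pc_depth :: "'a set \<Rightarrow> ('a \<Rightarrow> 'a \<Rightarrow> int) \<Rightarrow> nat" where
  "pc_depth \<Gamma> \<delta> = Max {k. \<exists>P Q. (P, Q) \<in> dag_edges \<Gamma> \<delta> ^^ k}"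


section \<open>Threshold circuits\<close>

text \<open>A circuit is a list of gates in topological order: wires are the positions of earlier gates
  in the list, and the last gate is the output. Parallel wires are permitted, so the size counts
  gates and wires.\<close>

datatype gate =
    Input nat
  | Not_Gate nat
  | And_Gate "nat list"
  | Or_Gate "nat list"
  | Maj_Gate "nat list"

type_synonym circuit = "gate list"

fun wires :: "gate \<Rightarrow> nat list" where
  "wires (Input i) = []"
| "wires (Not_Gate w) = [w]"
| "wires (And_Gate ws) = ws"
| "wires (Or_Gate ws) = ws"
| "wires (Maj_Gate ws) = ws"

definition circuit_wf :: "nat \<Rightarrow> circuit \<Rightarrow> bool" where
  "circuit_wf n c \<longleftrightarrow> c \<noteq> [] \<and> (\<forall>i. Input i \<in> set c \<longrightarrow> i < n) \<and>
     (\<forall>j < length c. \<forall>w \<in> set (wires (c ! j)). w < j)"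

fun gate_value :: "bool list \<Rightarrow> bool list \<Rightarrow> gate \<Rightarrow> bool" where
  "gate_value x vs (Input i) = x ! i"
| "gate_value x vs (Not_Gate w) = (\<not> vs ! w)"
| "gate_value x vs (And_Gate ws) = (\<forall>w \<in> set ws. vs ! w)"
| "gate_value x vs (Or_Gate ws) = (\<exists>w \<in> set ws. vs ! w)"
| "gate_value x vs (Maj_Gate ws) = (length ws < 2 * length (filter (\<lambda>w. vs ! w) ws))"

definition circuit_values :: "bool list \<Rightarrow> circuit \<Rightarrow> bool list" where
  "circuit_values x c = foldl (\<lambda>vs g. vs @ [gate_value x vs g]) [] c"

definition accepts :: "circuit \<Rightarrow> bool list \<Rightarrow> bool" where
  "accepts c x \<longleftrightarrow> last (circuit_values x c)"

definition circuit_size :: "circuit \<Rightarrow> nat" where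
  "circuit_size c = (\<Sum>g\<leftarrow>c. 1 + length (wires g))"

fun gate_depth :: "nat list \<Rightarrow> gate \<Rightarrow> nat" where
  "gate_depth ds (Input i) = 0"
| "gate_depth ds g = Suc (Max (insert 0 ((!) ds ` set (wires g))))"

definition circuit_depth :: "circuit \<Rightarrow> nat" where
  "circuit_depth c = Max (set (foldl (\<lambda>ds g. ds @ [gate_depth ds g]) [] c))"

definition TC :: "nat \<Rightarrow> bool list set set" where
  "TC k = {A. \<exists>c :: nat \<Rightarrow> circuit.
     (\<forall>n. circuit_wf n (c n)) \<and>
     (\<forall>x. x \<in> A \<longleftrightarrow> accepts (c (length x)) x) \<and>
     (\<exists>d :: nat. (\<lambda>n. real (circuit_size (c n))) \<in> O(\<lambda>n. real n ^ d)) \<and>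
     (\<lambda>n. real (circuit_depth (c n))) \<in> O(\<lambda>n. log 2 (real n) ^ k)}"


section \<open>The comparison problem\<close>

definition symbol_bits :: "int \<Rightarrow> bool list" where
  "symbol_bits a = [a < 0, a \<noteq> 0]"

definition encode_marking :: "nat \<Rightarrow> (nat \<Rightarrow> int) \<Rightarrow> bool list" where
  "encode_marking n M = concat (map (\<lambda>P. symbol_bits (M P)) [0..<n])"

definition encode_instance ::
    "nat \<Rightarrow> (nat \<Rightarrow> nat \<Rightarrow> int) \<Rightarrow> (nat \<Rightarrow> int) \<Rightarrow> (nat \<Rightarrow> int) \<Rightarrow> bool list" where
  "encode_instance n \<delta> L M =
     concat (map (\<lambda>P. encode_marking n (\<delta> P)) [0..<n]) @ encode_marking n L @ encode_marking n M"

text \<open>The language of encoded yes-instances; nodes of an encoded power circuit are numbered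
  \<open>0, \<dots>, n - 1\<close>.\<close>

definition comparison_problem :: "real \<Rightarrow> (real \<Rightarrow> real \<Rightarrow> bool) \<Rightarrow> bool list set" where
  "comparison_problem C rel = {encode_instance n \<delta> L M | n \<delta> L M.
     power_circuit {..<n} \<delta> \<and> real (pc_depth {..<n} \<delta>) \<le> C * log 2 (real n) \<and>
     marking {..<n} L \<and> marking {..<n} M \<and>
     rel (marking_eval {..<n} \<delta> L) (marking_eval {..<n} \<delta> M)}"

end

theory Submission
  imports Defs
begin

text \<open>
  Write \<open>e(P) = \<epsilon>(\<Lambda>\<^sub>P)\<close> and fix a power of two \<open>b = \<Theta>(log n)\<close>. Proceeding by height in
  the dag, one computes for every node the residue \<open>e(P) mod b\<close> and for every pair of nodes
  whether the quotient \<open>e(P) div b\<close> exceeds \<open>e(Q) div b\<close> by at least \<open>0\<close>, \<open>1\<close> or \<open>2\<close>. Both are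
  determined by the same information on the successors: the residue because only summands \<open>2^e\<close>
  with \<open>e < log b\<close> matter modulo \<open>b\<close>, the quotient comparison through the sign of a sum
  \<open>\<Sum>\<^sub>R c\<^sub>R 2^e(R)\<close> with small coefficients. To find that sign, collect the summands with
  equal \<open>e(R) div b\<close> into digits to the base \<open>2^b\<close>. The digits are polynomially bounded, and
  after a single local carry step into signed remainders all digits are smaller than the base,
  so that the sign is that of the leading nonzero digit. Hence one round takes threshold circuits
  of constant depth and polynomial size, and \<open>depth(\<Pi>) + 1 = O(log n)\<close> rounds suffice.
\<close>

section \<open>Layered circuits\<close>

text \<open>Exponents of nodes may be towers of twos, so they are never written down; the claims
  about residues and gaps are restricted to nodes whose height is already covered. The two kinds of
  data need each other: a gap of \<open>t\<close> between quotients means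
  \<open>e(P) - e(Q) >= t * b - (e(Q) mod b)\<close>, a sign question with a constant of size at
  most \<open>2 * b\<close>. Gaps up to 2 suffice because a digit position is named by the block of
  a node or the block above it, which receives its carry. The choice of \<open>b\<close> is squeezed
  from both sides: \<open>2 ^ b\<close> must exceed the sum of all coefficients by a margin of 3, so
  that one carry settles the digits, yet stay polynomial, because digits are held in unary and
  evaluated by table lookup. The input is not promised to be a power circuit. The same comparisons
  must also certify that no exponent is negative, although they are meaningful only above nodes
  already known to be valid; induction along the dag breaks this circle. The size stays polynomial
  over logarithmically many rounds because the results of a round are wires shared by the next
  one.\<close>

definition gate_depths :: "circuit \<Rightarrow> nat list" where
  "gate_depths c = foldl (\<lambda>ds g. ds @ [gate_depth ds g]) [] c"

lemma circuit_values_Nil [simp]: "circuit_values x [] = []"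
  by (simp add: circuit_values_def)

lemma circuit_values_snoc [simp]:
  "circuit_values x (c @ [g]) = circuit_values x c @ [gate_value x (circuit_values x c) g]"
  by (simp add: circuit_values_def)

lemma gate_depths_Nil [simp]: "gate_depths [] = []"
  by (simp add: gate_depths_def)

lemma gate_depths_snoc [simp]:
  "gate_depths (c @ [g]) = gate_depths c @ [gate_depth (gate_depths c) g]"
  by (simp add: gate_depths_def)

lemma length_circuit_values [simp]: "length (circuit_values x c) = length c"
  by (induction c rule: rev_induct) auto

lemma length_gate_depths [simp]: "length (gate_depths c) = length c"
  by (induction c rule: rev_induct) auto

lemma nth_circuit_values_append [simp]:
  "w < length c \<Longrightarrow> circuit_values x (c @ e) ! w = circuit_values x c ! w"
  by (induction e rule: rev_induct) (auto simp: nth_append simp flip: append_assoc)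

lemma nth_gate_depths_append [simp]:
  "w < length c \<Longrightarrow> gate_depths (c @ e) ! w = gate_depths c ! w"
  by (induction e rule: rev_induct) (auto simp: nth_append simp flip: append_assoc)

lemma gate_depth_le:
  assumes "\<And>w. w \<in> set (wires g) \<Longrightarrow> ds ! w \<le> d"
  shows "gate_depth ds g \<le> Suc d"
  using assms by (cases g) auto

definition gates_wf :: "nat \<Rightarrow> circuit \<Rightarrow> bool" where
  "gates_wf n c \<longleftrightarrow> (\<forall>i. Input i \<in> set c \<longrightarrow> i < n) \<and>
     (\<forall>j < length c. \<forall>w \<in> set (wires (c ! j)). w < j)"

lemma gates_wf_Nil [simp]: "gates_wf n []"
  by (simp add: gates_wf_def)

lemma gates_wf_snoc:
  "gates_wf n (c @ [g]) \<longleftrightarrow> gates_wf n c \<and> (\<forall>i. g = Input i \<longrightarrow> i < n) \<and>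
     (\<forall>w \<in> set (wires g). w < length c)"
  unfolding gates_wf_def by (fastforce simp: nth_append less_Suc_eq all_conj_distrib)

definition available :: "nat \<Rightarrow> circuit \<Rightarrow> nat \<Rightarrow> (bool list \<Rightarrow> bool) \<Rightarrow> bool" where
  "available n c d f \<longleftrightarrow> (\<exists>w < length c. gate_depths c ! w \<le> d \<and>
     (\<forall>x. length x = n \<longrightarrow> circuit_values x c ! w = f x))"

lemma available_append: "available n c d f \<Longrightarrow> available n (c @ e) d f"
  unfolding available_def
  by (metis length_append nth_circuit_values_append nth_gate_depths_append trans_less_add1)

lemma available_mono: "available n c d f \<Longrightarrow> d \<le> d' \<Longrightarrow> available n c d' f"
  unfolding available_def by (meson le_trans)

text \<open>The bound \<open>d\<close> concerns the wires carrying \<open>F\<close>, on which new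
  gates are stacked; \<open>D\<close> caps every gate, including those added meanwhile for other
  functions.\<close>

definition circuit_over :: "nat \<Rightarrow> (bool list \<Rightarrow> bool) set \<Rightarrow> nat \<Rightarrow> nat \<Rightarrow> circuit \<Rightarrow> bool" where
  "circuit_over n F d D c \<longleftrightarrow>
     gates_wf n c \<and> (\<forall>k \<in> set (gate_depths c). k \<le> D) \<and> (\<forall>g \<in> F. available n c d g)"

text \<open>Quantifying over every circuit over \<open>F\<close> lets extensions be chained: each
  leaves a circuit over \<open>F\<close> again, and \<open>s\<close> charges only the new
  gates.\<close>

definition buildable ::
    "nat \<Rightarrow> (bool list \<Rightarrow> bool) set \<Rightarrow> nat \<Rightarrow> nat \<Rightarrow> nat \<Rightarrow> nat \<Rightarrow> (bool list \<Rightarrow> bool) \<Rightarrow> bool" where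
  "buildable n F d D s d' f \<longleftrightarrow> (\<forall>c. circuit_over n F d D c \<longrightarrow>
     (\<exists>e. circuit_over n F d D (c @ e) \<and> circuit_size e \<le> s \<and> available n (c @ e) d' f))"

lemma circuit_size_append [simp]: "circuit_size (c @ e) = circuit_size c + circuit_size e"
  by (simp add: circuit_size_def)

lemma circuit_size_Nil [simp]: "circuit_size [] = 0"
  by (simp add: circuit_size_def)

lemma buildable_list:
  assumes "\<forall>f \<in> set fs. buildable n F d D s d' f" "circuit_over n F d D c"
  shows "\<exists>e. circuit_over n F d D (c @ e) \<and> circuit_size e \<le> length fs * s \<and>
    (\<forall>f \<in> set fs. available n (c @ e) d' f)"
  using assms(1)
proof (induction fs)
  case Nil
  then show ?case using assms(2) by (intro exI[of _ "[]"]) auto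
next
  case (Cons f fs)
  then obtain e where e: "circuit_over n F d D (c @ e)" "circuit_size e \<le> length fs * s"
    "\<forall>f \<in> set fs. available n (c @ e) d' f" by auto
  obtain e' where e': "circuit_over n F d D ((c @ e) @ e')" "circuit_size e' \<le> s"
    "available n ((c @ e) @ e') d' f"
    using Cons.prems e(1) unfolding buildable_def by (meson list.set_intros(1))
  show ?case
    using e e' available_append[of n "c @ e" d' _ e']
    by (intro exI[of _ "e @ e'"]) auto
qed

lemma circuit_over_snoc:
  assumes "circuit_over n F d D c" "\<forall>w \<in> set (wires g). w < length c \<and> gate_depths c ! w \<le> k"
    "\<forall>i. g \<noteq> Input i" "Suc k \<le> D"
    "\<And>x. length x = n \<Longrightarrow> gate_value x (circuit_values x c) g = f x"
  shows "circuit_over n F d D (c @ [g]) \<and> available n (c @ [g]) (Suc k) f"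
proof -
  have "gate_depth (gate_depths c) g \<le> Suc k"
    using assms(2) by (intro gate_depth_le) auto
  then show ?thesis
    using assms available_append[of n c _ _ "[g]"] unfolding circuit_over_def
    by (auto simp: gates_wf_snoc available_def[of _ "c @ [g]"] nth_append intro!: exI[of _ "length c"])
qed

text \<open>Equal functions in \<open>fs\<close> share a wire, but \<open>map w fs\<close> repeats
  that wire, so multiplicities survive, as majority gates require.\<close>

lemma buildable_gate:
  assumes fs: "\<forall>f \<in> set fs. buildable n F d D s k f" and "Suc k \<le> D"
    and g: "\<And>ws. length ws = length fs \<Longrightarrow> length (wires (g ws)) = length fs"
      "\<And>ws. length ws = length fs \<Longrightarrow> set (wires (g ws)) \<subseteq> set ws" "\<And>ws i. g ws \<noteq> Input i"
    and f: "\<And>x vs w. \<forall>p \<in> set fs. vs ! w p = p x \<Longrightarrow> gate_value x vs (g (map w fs)) = f x"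
  shows "buildable n F d D (length fs * s + length fs + 1) (Suc k) f"
  unfolding buildable_def
proof (intro allI impI)
  fix c assume "circuit_over n F d D c"
  from buildable_list[OF fs this] obtain e where e: "circuit_over n F d D (c @ e)"
    "circuit_size e \<le> length fs * s" "\<forall>f \<in> set fs. available n (c @ e) k f" by blast
  then obtain w where w: "\<forall>f \<in> set fs. w f < length (c @ e) \<and> gate_depths (c @ e) ! w f \<le> k \<and>
      (\<forall>x. length x = n \<longrightarrow> circuit_values x (c @ e) ! w f = f x)"
    unfolding available_def by metis
  have "circuit_over n F d D ((c @ e) @ [g (map w fs)]) \<and>
      available n ((c @ e) @ [g (map w fs)]) (Suc k) f"
  proof (rule circuit_over_snoc[OF e(1) _ _ assms(2)])
    show "\<forall>v\<in>set (wires (g (map w fs))). v < length (c @ e) \<and> gate_depths (c @ e) ! v \<le> k"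
      using g(2)[of "map w fs"] w by auto
  qed (use g(3) f w in auto)
  then show "\<exists>e. circuit_over n F d D (c @ e) \<and>
      circuit_size e \<le> length fs * s + length fs + 1 \<and> available n (c @ e) (Suc k) f"
    using e(2) g(1)[of "map w fs"]
    by (intro exI[of _ "e @ [g (map w fs)]"]) (auto simp: circuit_size_def)
qed

inductive tform :: "('x \<Rightarrow> bool) set \<Rightarrow> nat \<Rightarrow> nat \<Rightarrow> ('x \<Rightarrow> bool) \<Rightarrow> bool" for F m where
  tform_base: "f \<in> F \<Longrightarrow> tform F m d f"
| tform_Not: "tform F m d f \<Longrightarrow> tform F m (Suc d) (\<lambda>x. \<not> f x)"
| tform_And: "length fs \<le> m \<Longrightarrow> \<forall>f \<in> set fs. tform F m d f \<Longrightarrow>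
    tform F m (Suc d) (\<lambda>x. \<forall>f \<in> set fs. f x)"
| tform_Or: "length fs \<le> m \<Longrightarrow> \<forall>f \<in> set fs. tform F m d f \<Longrightarrow>
    tform F m (Suc d) (\<lambda>x. \<exists>f \<in> set fs. f x)"
| tform_Maj: "length fs \<le> m \<Longrightarrow> \<forall>f \<in> set fs. tform F m d f \<Longrightarrow>
    tform F m (Suc d) (\<lambda>x. length fs < 2 * length (filter (\<lambda>f. f x) fs))"

lemma buildable_mono:
  "buildable n F d D s k f \<Longrightarrow> s \<le> s' \<Longrightarrow> k \<le> k' \<Longrightarrow> buildable n F d D s' k' f"
  unfolding buildable_def by (meson available_mono le_trans)

text \<open>With \<open>X = (m + 3) ^ d\<close> the left side is \<open>l * X + 1\<close> and the
  right side \<open>(m + 1) * X + 2 * X - 1\<close>. The alternative \<open>l = 1\<close> is for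
  negation, whose single wire need not respect \<open>m\<close>.\<close>

lemma formula_size_step:
  fixes l m :: nat
  assumes "l \<le> m \<or> l = 1"
  shows "l * ((m + 3) ^ d - 1) + l + 1 \<le> (m + 3) ^ Suc d - 1"
proof -
  define X where "X = (m + 3) ^ d"
  have X: "X \<ge> 1" unfolding X_def by simp
  have "l * (X - 1) + l = l * X" using X by (cases X) auto
  moreover have "l * X \<le> (m + 1) * X" using assms by (intro mult_right_mono) auto
  moreover have "(m + 3) * X = (m + 1) * X + X + X" by (simp add: algebra_simps)
  ultimately show ?thesis using X by (simp flip: X_def)
qed

lemma tform_buildable:
  assumes "tform F m k f"
  shows "d + k \<le> D \<Longrightarrow> buildable n F d D ((m + 3) ^ k - 1) (d + k) f"
  using assms
proof (induction)
  case (tform_base f k)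
  then show ?case unfolding buildable_def
    by (auto intro!: exI[of _ "[]"] simp: circuit_over_def intro: available_mono[OF _ le_add1])
next
  case (tform_Not k f)
  have "buildable n F d D (length [f] * ((m + 3) ^ k - 1) + length [f] + 1)
      (Suc (d + k)) (\<lambda>x. \<not> f x)"
    using tform_Not
    by (intro buildable_gate[where g = "\<lambda>ws. Not_Gate (hd ws)" and fs = "[f]"])
      (auto simp: length_Suc_conv)
  then show ?case using formula_size_step[of 1 m k] by (auto intro: buildable_mono)
next
  case (tform_And fs k)
  have "buildable n F d D (length fs * ((m + 3) ^ k - 1) + length fs + 1)
      (Suc (d + k)) (\<lambda>x. \<forall>f \<in> set fs. f x)"
    by (rule buildable_gate[where g = And_Gate]) (use tform_And in auto)
  then show ?case using formula_size_step[of "length fs" m k] tform_And.hyps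
    by (auto intro: buildable_mono)
next
  case (tform_Or fs k)
  have "buildable n F d D (length fs * ((m + 3) ^ k - 1) + length fs + 1)
      (Suc (d + k)) (\<lambda>x. \<exists>f \<in> set fs. f x)"
    by (rule buildable_gate[where g = Or_Gate]) (use tform_Or in auto)
  then show ?case using formula_size_step[of "length fs" m k] tform_Or.hyps
    by (auto intro: buildable_mono)
next
  case (tform_Maj fs k)
  have "buildable n F d D (length fs * ((m + 3) ^ k - 1) + length fs + 1)
      (Suc (d + k)) (\<lambda>x. length fs < 2 * length (filter (\<lambda>f. f x) fs))"
    by (rule buildable_gate[where g = Maj_Gate])
      (use tform_Maj in \<open>auto simp: filter_map o_def cong: filter_cong\<close>)
  then show ?case using formula_size_step[of "length fs" m k] tform_Maj.hyps
    by (auto intro: buildable_mono)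
qed

text \<open>Here sharing happens: the trees for \<open>G\<close> are expanded once, at cost
  \<open>(m + 3) ^ k\<close> each, and their roots become wires for the next layer. Sizes of
  successive layers therefore add up instead of multiplying.\<close>

lemma layer:
  assumes c: "circuit_over n F d d c" and "finite G" "card G \<le> q"
    and G: "\<forall>f \<in> G. tform F m k f"
  shows "\<exists>e. circuit_over n (G \<union> F) (d + k) (d + k) (c @ e) \<and> circuit_size e \<le> q * (m + 3) ^ k"
proof -
  obtain fs where fs: "set fs = G" "distinct fs"
    using \<open>finite G\<close> finite_distinct_list by blast
  have "circuit_over n F d (d + k) c"
    using c by (fastforce simp: circuit_over_def)
  moreover have "\<forall>f \<in> set fs. buildable n F d (d + k) ((m + 3) ^ k - 1) (d + k) f"
    using G fs tform_buildable by blast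
  ultimately obtain e where e: "circuit_over n F d (d + k) (c @ e)"
    "circuit_size e \<le> length fs * ((m + 3) ^ k - 1)"
    "\<forall>f \<in> set fs. available n (c @ e) (d + k) f"
    using buildable_list by blast
  have "length fs * ((m + 3) ^ k - 1) \<le> q * (m + 3) ^ k"
    using assms(3) fs distinct_card[of fs] by (intro mult_mono) auto
  then show ?thesis using e fs unfolding circuit_over_def
    by (intro exI[of _ e]) (auto intro: available_mono)
qed

definition input_bits :: "nat \<Rightarrow> (bool list \<Rightarrow> bool) set" where
  "input_bits n = (\<lambda>i x. x ! i) ` {..<n}"

lemma circuit_over_input_bits:
  "circuit_over n (input_bits n) 0 0 (map Input [0..<n])"
proof -
  have "circuit_over n (input_bits m) 0 0 (map Input [0..<m])" if "m \<le> n" for m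
    using that
  proof (induction m)
    case 0
    then show ?case by (simp add: circuit_over_def input_bits_def)
  next
    case (Suc m)
    have *: "available n (map Input [0..<m] @ [Input m]) 0 (\<lambda>x. x ! m)"
      unfolding available_def by (auto intro!: exI[of _ m] simp: nth_append)
    have "input_bits (Suc m) = insert (\<lambda>x. x ! m) (input_bits m)"
      by (auto simp: input_bits_def lessThan_Suc)
    then show ?case using Suc * available_append[of n _ 0 _ "[Input m]"]
      by (auto simp: circuit_over_def gates_wf_snoc)
  qed
  then show ?thesis by blast
qed

lemma layers:
  assumes "\<And>h. finite (F h)" "\<And>h. card (F h) \<le> q"
    and "F 0 = {}"
    and "\<And>h f. f \<in> F (Suc h) \<Longrightarrow> tform (F h \<union> input_bits n) m k f"
  shows "\<exists>c. circuit_over n (F h \<union> input_bits n) (h * k) (h * k) c \<and>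
    circuit_size c \<le> n + h * (q * (m + 3) ^ k)"
proof (induction h)
  case 0
  have "circuit_size (map Input [0..<n]) = n"
    by (simp add: circuit_size_def o_def sum_list_triv)
  then show ?case using circuit_over_input_bits[of n] assms(3) by auto
next
  case (Suc h)
  then obtain c where c: "circuit_over n (F h \<union> input_bits n) (h * k) (h * k) c"
    "circuit_size c \<le> n + h * (q * (m + 3) ^ k)" by blast
  obtain e where e: "circuit_over n (F (Suc h) \<union> (F h \<union> input_bits n)) (h * k + k) (h * k + k) (c @ e)"
    "circuit_size e \<le> q * (m + 3) ^ k"
    using layer[OF c(1) assms(1,2), of "Suc h"] assms(4) by blast
  from e(1) have "circuit_over n (F (Suc h) \<union> input_bits n) (Suc h * k) (Suc h * k) (c @ e)"
    by (auto simp: circuit_over_def algebra_simps)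
  then show ?case using c(2) e(2) by (intro exI[of _ "c @ e"]) auto
qed

lemma layered_circuit:
  assumes "\<And>h. finite (F h)" "\<And>h. card (F h) \<le> q"
    and "F 0 = {}"
    and "\<And>h f. f \<in> F (Suc h) \<Longrightarrow> tform (F h \<union> input_bits n) m k f"
    and "tform (F h \<union> input_bits n) m k acc"
  shows "\<exists>c. circuit_wf n c \<and> (\<forall>x. length x = n \<longrightarrow> accepts c x = acc x) \<and>
    circuit_size c \<le> n + h * (q * (m + 3) ^ k) + (m + 3) ^ k + 2 \<and>
    circuit_depth c \<le> h * k + k + 1"
proof -
  obtain c where c: "circuit_over n (F h \<union> input_bits n) (h * k) (h * k) c"
    "circuit_size c \<le> n + h * (q * (m + 3) ^ k)"
    using layers[of F q n m k h] assms(1-4) by blast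
  obtain e where e: "circuit_over n ({acc} \<union> (F h \<union> input_bits n)) (h * k + k) (h * k + k) (c @ e)"
    "circuit_size e \<le> 1 * (m + 3) ^ k"
    using layer[OF c(1), of "{acc}" 1 m k] assms(5) by auto
  from e(1) obtain w where w: "w < length (c @ e)"
    "\<forall>x. length x = n \<longrightarrow> circuit_values x (c @ e) ! w = acc x"
    by (auto simp: circuit_over_def available_def)
  \<comment> \<open>The wire computing \<open>acc\<close> need not be the last gate; a one-input And
    gate copies it to the output position, at the price of one level and size 2.\<close>
  define c' where "c' = (c @ e) @ [And_Gate [w]]"
  have ds: "\<forall>d \<in> set (gate_depths (c @ e)). d \<le> h * k + k" and "gates_wf n (c @ e)"
    using e(1) by (auto simp: circuit_over_def)
  then have "gates_wf n c'" using w(1) unfolding c'_def by (subst gates_wf_snoc) auto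
  moreover have "accepts c' x = acc x" if "length x = n" for x
    unfolding accepts_def c'_def circuit_values_snoc using w(2) that by simp
  moreover have "circuit_depth c' \<le> h * k + k + 1"
  proof -
    have "gate_depths (c @ e) ! w \<le> h * k + k" using ds w(1) by simp
    then have "\<forall>d \<in> set (gate_depths c'). d \<le> h * k + k + 1"
      unfolding c'_def gate_depths_snoc using ds by auto
    moreover have "gate_depths c' \<noteq> []" by (simp add: c'_def flip: length_0_conv)
    ultimately show ?thesis
      unfolding circuit_depth_def gate_depths_def[symmetric] by (subst Max_le_iff) auto
  qed
  moreover have "circuit_size c' \<le> n + h * (q * (m + 3) ^ k) + (m + 3) ^ k + 2"
    using c(2) e(2) by (auto simp: c'_def circuit_size_def)
  ultimately show ?thesis
    by (intro exI[of _ c']) (auto simp: circuit_wf_def gates_wf_def c'_def)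
qed

section \<open>Threshold formulas\<close>

lemma tform_mono: "tform F m d f \<Longrightarrow> d \<le> d' \<Longrightarrow> tform F m d' f"
proof (induction arbitrary: d' rule: tform.induct)
  case (tform_base f d)
  then show ?case by (blast intro: tform.tform_base)
next
  case (tform_Not d f)
  then show ?case using tform.tform_Not[of F m "d' - 1" f] by (cases d') auto
next
  case (tform_And fs d)
  then show ?case using tform.tform_And[of fs m F "d' - 1"] by (cases d') auto
next
  case (tform_Or fs d)
  then show ?case using tform.tform_Or[of fs m F "d' - 1"] by (cases d') auto
next
  case (tform_Maj fs d)
  then show ?case using tform.tform_Maj[of fs m F "d' - 1"] by (cases d') auto
qed

lemma tform_ball:
  assumes "finite I" "card I \<le> m" "\<And>i. i \<in> I \<Longrightarrow> tform F m d (f i)"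
  shows "tform F m (Suc d) (\<lambda>x. \<forall>i \<in> I. f i x)"
proof -
  obtain js where "set js = I" "distinct js"
    using assms(1) finite_distinct_list by blast
  then show ?thesis
    using tform_And[of "map f js" m F d] assms(2,3) distinct_card[of js] by auto
qed

lemma tform_bex:
  assumes "finite I" "card I \<le> m" "\<And>i. i \<in> I \<Longrightarrow> tform F m d (f i)"
  shows "tform F m (Suc d) (\<lambda>x. \<exists>i \<in> I. f i x)"
proof -
  obtain js where "set js = I" "distinct js"
    using assms(1) finite_distinct_list by blast
  then show ?thesis
    using tform_Or[of "map f js" m F d] assms(2,3) distinct_card[of js] by auto
qed

lemma tform_conj:
  "2 \<le> m \<Longrightarrow> tform F m d f \<Longrightarrow> tform F m d g \<Longrightarrow> tform F m (Suc d) (\<lambda>x. f x \<and> g x)"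
  using tform_And[of "[f, g]" m F d] by simp

lemma tform_disj:
  "2 \<le> m \<Longrightarrow> tform F m d f \<Longrightarrow> tform F m d g \<Longrightarrow> tform F m (Suc d) (\<lambda>x. f x \<or> g x)"
  using tform_Or[of "[f, g]" m F d] by simp

lemma tform_const: "tform F m (Suc d) (\<lambda>x. c)"
  using tform_And[of "[]" m F d] tform_Or[of "[]" m F d] by (cases c) simp_all

abbreviation true_count :: "('x \<Rightarrow> bool) list \<Rightarrow> 'x \<Rightarrow> nat" where
  "true_count ps x \<equiv> length (filter (\<lambda>p. p x) ps)"

text \<open>Padding with constants shifts the threshold of a majority gate.\<close>

lemma tform_threshold:
  assumes ps: "\<forall>p \<in> set ps. tform F m (Suc d) p" and m: "2 * length ps + 1 \<le> m"
  shows "tform F m (Suc (Suc d)) (\<lambda>x. t \<le> true_count ps x)"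
proof (cases "t = 0 \<or> t > length ps")
  case True
  then have "(\<lambda>x. t \<le> true_count ps x) = (\<lambda>x. t = 0)"
    using order.trans[OF _ length_filter_le] by (fastforce simp: fun_eq_iff)
  then show ?thesis by (metis tform_const)
next
  case False
  \<comment> \<open>Truncated subtraction makes at most one of \<open>a\<close>, \<open>b\<close>
    nonzero; in either case the majority test becomes
    \<open>2 * t - 1 < 2 * true_count ps x\<close>.\<close>
  define a b where "a = length ps + 1 - 2 * t" "b = 2 * t - 1 - length ps"
  define fs :: "('a \<Rightarrow> bool) list"
    where "fs = ps @ replicate a (\<lambda>x. True) @ replicate b (\<lambda>x. False)"
  have "(length fs < 2 * true_count fs x) = (t \<le> true_count ps x)" for x
    using False by (auto simp: fs_def a_b_def)
  moreover have "length fs \<le> m" "\<forall>f \<in> set fs. tform F m (Suc d) f"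
    using m False ps tform_const by (auto simp: fs_def a_b_def)
  ultimately show ?thesis using tform_Maj[of fs m F "Suc d"] by simp
qed

text \<open>Integers in signed unary, as a difference of two counts of true formulas. The number
  \<open>k\<close> of formulas bounds both the fan-in needed to inspect the value and the range of
  the value.\<close>

definition unary_sum :: "('x \<Rightarrow> bool) set \<Rightarrow> nat \<Rightarrow> nat \<Rightarrow> nat \<Rightarrow> ('x \<Rightarrow> int) \<Rightarrow> bool" where
  "unary_sum F m d k f \<longleftrightarrow> (\<exists>ps qs. length ps + length qs \<le> k \<and>
     (\<forall>p \<in> set ps \<union> set qs. tform F m d p) \<and>
     (\<forall>x. f x = int (true_count ps x) - int (true_count qs x)))"

lemma unary_sum_mono:
  "unary_sum F m d k f \<Longrightarrow> d \<le> d' \<Longrightarrow> k \<le> k' \<Longrightarrow> unary_sum F m d' k' f"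
  unfolding unary_sum_def by (meson le_trans tform_mono)

lemma unary_sum_of_bool: "tform F m d p \<Longrightarrow> unary_sum F m d 1 (\<lambda>x. of_bool (p x))"
  unfolding unary_sum_def by (intro exI[of _ "[p]"] exI[of _ "[]"]) auto

lemma unary_sum_uminus: "unary_sum F m d k f \<Longrightarrow> unary_sum F m d k (\<lambda>x. - f x)"
  unfolding unary_sum_def by (metis add.commute minus_diff_eq sup_commute)

lemma unary_sum_add:
  assumes "unary_sum F m d k f" "unary_sum F m d l g"
  shows "unary_sum F m d (k + l) (\<lambda>x. f x + g x)"
proof -
  obtain ps qs ps' qs' where "length ps + length qs \<le> k" "length ps' + length qs' \<le> l"
    "\<forall>p \<in> set ps \<union> set qs. tform F m d p" "\<forall>p \<in> set ps' \<union> set qs'. tform F m d p"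
    "\<forall>x. f x = int (true_count ps x) - int (true_count qs x)"
    "\<forall>x. g x = int (true_count ps' x) - int (true_count qs' x)"
    using assms unfolding unary_sum_def by blast
  then show ?thesis
    unfolding unary_sum_def by (intro exI[of _ "ps @ ps'"] exI[of _ "qs @ qs'"]) auto
qed

lemma unary_sum_diff:
  "unary_sum F m d k f \<Longrightarrow> unary_sum F m d l g \<Longrightarrow> unary_sum F m d (k + l) (\<lambda>x. f x - g x)"
  using unary_sum_add[of F m d k f l "\<lambda>x. - g x"] unary_sum_uminus by fastforce

lemma unary_sum_zero: "unary_sum F m d k (\<lambda>x. 0)"
  unfolding unary_sum_def by (intro exI[of _ "[]"]) auto

lemma unary_sum_sum:
  assumes "\<And>i. i \<in> I \<Longrightarrow> unary_sum F m d k (f i)"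
  shows "unary_sum F m d (card I * k) (\<lambda>x. \<Sum>i\<in>I. f i x)"
  using assms
proof (induction I rule: infinite_finite_induct)
  case (insert i I)
  have "unary_sum F m d (k + card I * k) (\<lambda>x. f i x + (\<Sum>i\<in>I. f i x))"
    by (intro unary_sum_add insert) auto
  then show ?case by (simp add: insert.hyps)
qed (simp_all add: unary_sum_zero)

lemma unary_sum_cmult:
  assumes "unary_sum F m d k f"
  shows "unary_sum F m d (nat \<bar>c\<bar> * k) (\<lambda>x. c * f x)"
proof -
  have pos: "unary_sum F m d (n * k) (\<lambda>x. int n * f x)" for n
  proof (induction n)
    case (Suc n)
    have "unary_sum F m d (k + n * k) (\<lambda>x. f x + int n * f x)"
      by (intro unary_sum_add assms Suc)
    then show ?case by (simp add: distrib_right)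
  qed (simp add: unary_sum_zero)
  then show ?thesis
    using pos[of "nat c"] unary_sum_uminus[OF pos[of "nat (- c)"]] by (cases "c \<ge> 0") auto
qed

lemma unary_sum_mult_of_bool:
  assumes "2 \<le> m" "unary_sum F m d k f" "tform F m d b"
  shows "unary_sum F m (Suc d) k (\<lambda>x. f x * of_bool (b x))"
proof -
  obtain ps qs where *: "length ps + length qs \<le> k" "\<forall>p \<in> set ps \<union> set qs. tform F m d p"
    "\<forall>x. f x = int (true_count ps x) - int (true_count qs x)"
    using assms(2) unfolding unary_sum_def by blast
  define c where "c = map (\<lambda>p x. p x \<and> b x)"
  have "true_count (c ps) x = (if b x then true_count ps x else 0)" for ps x
    by (auto simp: c_def filter_map o_def)
  moreover have "\<forall>p \<in> set (c ps) \<union> set (c qs). tform F m (Suc d) p"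
    using assms *(2) by (auto simp: c_def intro!: tform_conj)
  ultimately show ?thesis
    unfolding unary_sum_def using *
    by (intro exI[of _ "c ps"] exI[of _ "c qs"]) (auto simp: c_def)
qed

lemma unary_sum_ge:
  assumes "unary_sum F m d k f" "2 * k + 1 \<le> m"
  shows "tform F m (d + 3) (\<lambda>x. v \<le> f x)"
proof -
  obtain ps qs where *: "length ps + length qs \<le> k" "\<forall>p \<in> set ps \<union> set qs. tform F m d p"
    "\<forall>x. f x = int (true_count ps x) - int (true_count qs x)"
    using assms(1) unfolding unary_sum_def by blast
  \<comment> \<open>Negating the formulas of \<open>qs\<close> turns their subtraction into a count,
    shifted by the constant \<open>length qs\<close>, so one threshold decides the
    inequality.\<close>
  define rs where "rs = ps @ map (\<lambda>q x. \<not> q x) qs"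
  have "true_count rs x + true_count qs x = true_count ps x + length qs" for x
    using sum_length_filter_compl[of "\<lambda>q. q x" qs] by (simp add: rs_def filter_map o_def)
  then have rs: "int (true_count rs x) + int (true_count qs x) = int (true_count ps x) + int (length qs)" for x
    by (metis of_nat_add)
  have "int (true_count rs x) = f x + int (length qs)" for x
    using rs[of x] *(3)[rule_format, of x] by linarith
  then have "(v \<le> f x) = (nat (v + int (length qs)) \<le> true_count rs x)" for x
    by (simp add: nat_le_iff)
  moreover have "\<forall>r \<in> set rs. tform F m (Suc (Suc d)) r"
    using *(2) by (auto simp: rs_def intro: tform_mono intro!: tform_Not)
  ultimately show ?thesis
    using tform_threshold[of rs F m "Suc d"] *(1) assms(2)
    by (auto simp: rs_def numeral_3_eq_3)
qed

lemma unary_sum_abs_le: "unary_sum F m d k f \<Longrightarrow> \<bar>f x\<bar> \<le> int k"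
  unfolding unary_sum_def
  by (smt (verit) length_filter_le of_nat_add of_nat_le_iff of_nat_0_le_iff)

lemma unary_sum_eq:
  assumes "unary_sum F m d k f" "2 * k + 1 \<le> m" "2 \<le> m"
  shows "tform F m (d + 5) (\<lambda>x. f x = v)"
proof -
  have "(\<lambda>x. f x = v) = (\<lambda>x. v \<le> f x \<and> \<not> v + 1 \<le> f x)" by auto
  moreover have "tform F m (Suc (Suc (d + 3))) (\<lambda>x. v \<le> f x \<and> \<not> v + 1 \<le> f x)"
    by (intro tform_conj tform_Not unary_sum_ge[OF assms(1,2)] assms(3)
        tform_mono[OF unary_sum_ge[OF assms(1,2)]]) simp
  ultimately show ?thesis by (simp add: numeral_eq_Suc)
qed

text \<open>Values lie in \<open>{-k..k}\<close>, so any relation is a disjunction over at most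
  \<open>(2 * k + 1)\<^sup>2\<close> pairs. This lookup replaces circuits for division, remainders
  and carries.\<close>

lemma unary_sum_pred2:
  assumes "unary_sum F m d k f" "unary_sum F m d k g" "(2 * k + 1)\<^sup>2 \<le> m" "2 \<le> m"
  shows "tform F m (d + 7) (\<lambda>x. R (f x) (g x))"
proof -
  let ?I = "{-int k..int k}"
  let ?J = "{(u, v). u \<in> ?I \<and> v \<in> ?I \<and> R u v}"
  have k: "2 * k + 1 \<le> m"
    using self_le_power[of "2 * k + 1" 2] assms(3) by simp
  have sub: "?J \<subseteq> ?I \<times> ?I" by auto
  then have fin: "finite ?J" by (rule finite_subset) auto
  have "card ?J \<le> card (?I \<times> ?I)" by (rule card_mono[OF _ sub]) auto
  also have "\<dots> \<le> m"
    using assms(3) by (simp add: power2_eq_square nat_add_distrib nat_mult_distrib algebra_simps)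
  finally have card: "card ?J \<le> m" .
  have "R (f x) (g x) \<longleftrightarrow> (\<exists>j \<in> ?J. f x = fst j \<and> g x = snd j)" for x
    using unary_sum_abs_le[OF assms(1), of x] unary_sum_abs_le[OF assms(2), of x] by auto
  moreover have "tform F m (Suc (Suc (d + 5))) (\<lambda>x. \<exists>j \<in> ?J. f x = fst j \<and> g x = snd j)"
    by (intro tform_bex fin card tform_conj assms unary_sum_eq[OF assms(1) k]
        unary_sum_eq[OF assms(2) k])
  ultimately show ?thesis by (simp add: numeral_eq_Suc)
qed

lemma unary_sum_pred:
  assumes "unary_sum F m d k f" "(2 * k + 1)\<^sup>2 \<le> m" "2 \<le> m"
  shows "tform F m (d + 7) (\<lambda>x. R (f x))"
  using unary_sum_pred2[OF assms(1,1,2,3), of "\<lambda>u v. R u"] .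

section \<open>Signs of sums of powers of two\<close>

lemma digit_sum_bound:
  fixes z :: "nat \<Rightarrow> int"
  assumes "\<And>k. \<bar>z k\<bar> \<le> B - 1"
  shows "\<bar>\<Sum>k<K. z k * B ^ k\<bar> \<le> B ^ K - 1"
proof (induction K)
  case (Suc K)
  have "B \<ge> 1" using assms[of 0] by linarith
  then have "\<bar>z K * B ^ K\<bar> \<le> (B - 1) * B ^ K"
    using assms[of K] by (simp add: abs_mult mult_right_mono)
  then have "\<bar>z K * B ^ K\<bar> \<le> B * B ^ K - B ^ K" by (simp add: algebra_simps)
  then show ?case using Suc by simp
qed simp

text \<open>The lower digits contribute at most \<open>B ^ k - 1\<close> in absolute value, less
  than any nonzero multiple of \<open>B ^ k\<close>.\<close>

lemma top_digit_sign:
  fixes z :: "nat \<Rightarrow> int"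
  assumes B: "\<And>k. \<bar>z k\<bar> \<le> B - 1" and "z k \<noteq> 0" "k < K" and top: "\<forall>k' > k. z k' = 0"
  shows "sgn (\<Sum>k<K. z k * B ^ k) = sgn (z k)"
proof -
  have "B > 0" using B[of 0] by linarith
  then have pow: "B ^ k > 0" by simp
  have "(\<Sum>k<K. z k * B ^ k) = (\<Sum>k<Suc k. z k * B ^ k)"
    using assms(3) top by (intro sum.mono_neutral_right) auto
  then have S: "(\<Sum>k<K. z k * B ^ k) = z k * B ^ k + (\<Sum>k<k. z k * B ^ k)" by simp
  have bound: "\<bar>\<Sum>k<k. z k * B ^ k\<bar> \<le> B ^ k - 1"
    by (rule digit_sum_bound[OF B])
  show ?thesis
  proof (cases "z k > 0")
    case True
    then have "z k * B ^ k \<ge> 1 * B ^ k" using pow by (intro mult_right_mono) auto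
    then show ?thesis using True S bound by (auto simp: sgn_if)
  next
    case False
    then have "z k * B ^ k \<le> (- 1) * B ^ k" using pow assms(2) by (intro mult_right_mono) auto
    then show ?thesis using False S bound assms(2) by (auto simp: sgn_if)
  qed
qed

text \<open>The criterion on the right is free of \<open>K\<close>, so it can later be matched with
  a search over the positions that nodes can name.\<close>

lemma digit_sum_neg_iff:
  fixes z :: "nat \<Rightarrow> int"
  assumes B: "\<And>k. \<bar>z k\<bar> \<le> B - 1" and z: "\<And>k. k \<ge> K \<Longrightarrow> z k = 0"
  shows "(\<Sum>k<K. z k * B ^ k) < 0 \<longleftrightarrow> (\<exists>k. z k < 0 \<and> (\<forall>k' > k. z k' = 0))"
proof
  assume neg: "(\<Sum>k<K. z k * B ^ k) < 0"
  define T where "T = {k. z k \<noteq> 0}"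
  have "T \<subseteq> {..<K}" unfolding T_def using z by (metis (mono_tags) lessThan_iff mem_Collect_eq not_le subsetI)
  then have "finite T" by (rule finite_subset) simp
  have "T \<noteq> {}"
  proof
    assume "T = {}"
    then have "z k = 0" for k by (auto simp: T_def)
    then show False using neg by simp
  qed
  define k where "k = Max T"
  have k: "z k \<noteq> 0" using Max_in[OF \<open>finite T\<close> \<open>T \<noteq> {}\<close>] by (simp add: k_def T_def)
  then have "k < K" using z by (meson not_le)
  have top: "\<forall>k' > k. z k' = 0"
    using Max_ge[OF \<open>finite T\<close>] by (force simp: k_def T_def not_le[symmetric])
  have "sgn (\<Sum>k<K. z k * B ^ k) = sgn (z k)"
    using B k \<open>k < K\<close> top by (rule top_digit_sign)
  then have "z k < 0" using neg by (metis sgn_less)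
  then show "\<exists>k. z k < 0 \<and> (\<forall>k' > k. z k' = 0)" using top by blast
next
  assume "\<exists>k. z k < 0 \<and> (\<forall>k' > k. z k' = 0)"
  then obtain k where k: "z k < 0" "\<forall>k' > k. z k' = 0" by blast
  then have "k < K" using z by (metis less_irrefl not_le)
  have "sgn (\<Sum>k<K. z k * B ^ k) = sgn (z k)"
    using B _ \<open>k < K\<close> k(2) by (rule top_digit_sign) (use k in auto)
  then show "(\<Sum>k<K. z k * B ^ k) < 0" using k(1) by (metis sgn_less)
qed

text \<open>Quotient for balanced division by the base \<open>2 * H\<close>: adding \<open>H\<close>
  first rounds to a nearest multiple, which leaves a signed remainder of absolute value at most
  \<open>H\<close> and thus room for an incoming carry.\<close>

definition high :: "int \<Rightarrow> int \<Rightarrow> int" where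
  "high H y = (y + H) div (2 * H)"

definition low :: "int \<Rightarrow> int \<Rightarrow> int" where
  "low H y = (y + H) mod (2 * H) - H"

lemma low_high: "low H y + high H y * (2 * H) = y"
  unfolding low_def high_def using div_mult_mod_eq[of "y + H" "2 * H"] by linarith

lemma abs_low_le: "H > 0 \<Longrightarrow> \<bar>low H y\<bar> \<le> H"
  unfolding low_def using pos_mod_bound[of "2 * H" "y + H"] pos_mod_sign[of "2 * H" "y + H"]
  by linarith

lemma abs_high_le:
  assumes "H > 0" "\<bar>y\<bar> \<le> W * H"
  shows "2 * \<bar>high H y\<bar> \<le> W + 1"
proof -
  have "high H y * (2 * H) \<le> (W + 1) * H" "- high H y * (2 * H) \<le> (W + 1) * H"
    using low_high[of H y] abs_low_le[OF assms(1), of y] assms(2) by (auto simp: algebra_simps)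
  then have "(2 * high H y) * H \<le> (W + 1) * H" "(- (2 * high H y)) * H \<le> (W + 1) * H"
    by (auto simp: algebra_simps)
  then have "2 * high H y \<le> W + 1" "- (2 * high H y) \<le> W + 1"
    using mult_right_le_imp_le[OF _ assms(1)] by blast+
  then show ?thesis by linarith
qed

lemma high_zero [simp]: "H > 0 \<Longrightarrow> high H 0 = 0"
  by (simp add: high_def)

lemma low_zero [simp]: "H > 0 \<Longrightarrow> low H 0 = 0"
  by (simp add: low_def)

text \<open>Integer positions give position 0 a predecessor, \<open>y (- 1)\<close>, which is zero
  for the digits considered later.\<close>

definition carried :: "int \<Rightarrow> (int \<Rightarrow> int) \<Rightarrow> int \<Rightarrow> int" where
  "carried H y k = low H (y k) + high H (y (k - 1))"

text \<open>Telescoping: the carry removed at a position re-enters at the next one, which leaves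
  only the carry out of the last position.\<close>

lemma sum_carried:
  assumes "H > 0" "y (- 1) = 0"
  shows "(\<Sum>k<K. carried H y (int k) * (2 * H) ^ k) =
    (\<Sum>k<K. y (int k) * (2 * H) ^ k) - high H (y (int K - 1)) * (2 * H) ^ K"
proof (induction K)
  case 0
  then show ?case using assms by simp
next
  case (Suc K)
  have "y (int K) * (2 * H) ^ K = low H (y (int K)) * (2 * H) ^ K + high H (y (int K)) * (2 * H) ^ Suc K"
    by (subst low_high[symmetric, of _ H]) (simp only: power_Suc algebra_simps)
  then show ?case using Suc by (simp add: carried_def distrib_right)
qed

definition block_sum :: "'i set \<Rightarrow> ('i \<Rightarrow> int) \<Rightarrow> ('i \<Rightarrow> int) \<Rightarrow> nat \<Rightarrow> int \<Rightarrow> int" where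
  "block_sum I c E b k =
     (\<Sum>R\<in>I. c R * of_bool (E R div int b = k) * 2 ^ nat (E R mod int b))"

lemma block_sum_eq_0:
  "(\<And>R. R \<in> I \<Longrightarrow> c R \<noteq> 0 \<Longrightarrow> E R div int b \<noteq> k) \<Longrightarrow> block_sum I c E b k = 0"
  unfolding block_sum_def by (intro sum.neutral) auto

lemma block_sum_bound:
  assumes "b > 0"
  shows "\<bar>block_sum I c E b k\<bar> \<le> (\<Sum>R\<in>I. \<bar>c R\<bar>) * 2 ^ (b - 1)"
proof -
  have e: "nat (E R mod int b) \<le> b - 1" for R
    using pos_mod_bound[of "int b" "E R"] assms by linarith
  have "\<bar>block_sum I c E b k\<bar> \<le> (\<Sum>R\<in>I. \<bar>c R * of_bool (E R div int b = k) * 2 ^ nat (E R mod int b)\<bar>)"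
    unfolding block_sum_def by (rule sum_abs)
  also have "\<dots> \<le> (\<Sum>R\<in>I. \<bar>c R\<bar> * 2 ^ (b - 1))"
    by (intro sum_mono) (auto simp: abs_mult intro!: mult_left_mono e[simplified])
  finally show ?thesis by (simp add: sum_distrib_right)
qed

text \<open>Regrouping by \<open>E R div b\<close>, since
  \<open>2 ^ E = 2 ^ (E mod b) * (2 ^ b) ^ (E div b)\<close>. Exponents are constrained only where
  the coefficient is nonzero, as other nodes may be invalid.\<close>

lemma sum_blocks:
  assumes "finite I" "b > 0" "\<And>R. R \<in> I \<Longrightarrow> c R \<noteq> 0 \<Longrightarrow> 0 \<le> E R \<and> E R div int b < int K"
  shows "(\<Sum>R\<in>I. c R * 2 ^ nat (E R)) = (\<Sum>k<K. block_sum I c E b (int k) * (2 ^ b) ^ k)"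
proof -
  have "c R * 2 ^ nat (E R) =
      (\<Sum>k<K. c R * of_bool (E R div int b = int k) * 2 ^ nat (E R mod int b) * (2 ^ b) ^ k)"
    if "R \<in> I" for R
  proof (cases "c R = 0")
    case False
    define q where "q = nat (E R div int b)"
    have q: "E R div int b = int q"
      using assms(2) assms(3)[OF that False] by (simp add: q_def pos_imp_zdiv_nonneg_iff)
    then have "q < K" using assms(3)[OF that False] by simp
    have "E R = int b * int q + E R mod int b"
      using mult_div_mod_eq[of "int b" "E R"] q by simp
    then have "nat (E R) = b * q + nat (E R mod int b)"
      using assms(2) pos_mod_sign[of "int b" "E R"]
      by (metis nat_add_distrib nat_int of_nat_0_le_iff of_nat_0_less_iff of_nat_mult)
    then have "(2::int) ^ nat (E R) = 2 ^ nat (E R mod int b) * (2 ^ b) ^ q"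
      by (simp add: power_add power_mult)
    moreover have "(\<Sum>k<K. c R * of_bool (E R div int b = int k) * 2 ^ nat (E R mod int b) * (2 ^ b) ^ k) =
        (\<Sum>k<K. if k = q then c R * 2 ^ nat (E R mod int b) * (2 ^ b) ^ q else 0)"
      using q by (intro sum.cong) auto
    ultimately show ?thesis using \<open>q < K\<close> by simp
  qed simp
  then have "(\<Sum>R\<in>I. c R * 2 ^ nat (E R)) =
      (\<Sum>R\<in>I. \<Sum>k<K. c R * of_bool (E R div int b = int k) * 2 ^ nat (E R mod int b) * (2 ^ b) ^ k)"
    by (intro sum.cong) auto
  also have "\<dots> = (\<Sum>k<K. block_sum I c E b (int k) * (2 ^ b) ^ k)"
    by (subst sum.swap) (simp add: block_sum_def sum_distrib_right)
  finally show ?thesis .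
qed

text \<open>After one round of carries every digit has absolute value below the base, so no further
  carry propagation is needed: the leading nonzero digit determines the sign.\<close>

lemma sum_neg_iff_leading_digit:
  assumes "finite I" "b > 0" and E: "\<And>R. R \<in> I \<Longrightarrow> c R \<noteq> 0 \<Longrightarrow> 0 \<le> E R"
    and W: "(\<Sum>R\<in>I. \<bar>c R\<bar>) + 3 \<le> 2 ^ b"
  defines "z \<equiv> carried (2 ^ (b - 1)) (block_sum I c E b)"
  shows "(\<Sum>R\<in>I. c R * 2 ^ nat (E R)) < 0 \<longleftrightarrow> (\<exists>k. z (int k) < 0 \<and> (\<forall>k' > k. z (int k') = 0))"
proof -
  define H :: int where "H = 2 ^ (b - 1)"
  have H: "H > 0" "2 * H = 2 ^ b"
    using \<open>b > 0\<close> by (auto simp: H_def simp flip: power_Suc)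
  let ?y = "block_sum I c E b"
  \<comment> \<open>One more than is needed to cover all blocks: position \<open>K - 1\<close> stays
    empty, so no carry leaves the top.\<close>
  define K where "K = Suc (Suc (nat (Max (insert 0 ((\<lambda>R. E R div int b) ` I)))))"
  have K: "E R div int b < int K - 1" if "R \<in> I" for R
  proof -
    have "E R div int b \<le> Max (insert 0 ((\<lambda>R. E R div int b) ` I))"
      using that assms(1) by (intro Max_ge) auto
    then show ?thesis unfolding K_def by linarith
  qed
  have y0: "?y k = 0" if "k < 0 \<or> k \<ge> int K - 1" for k
  proof (rule block_sum_eq_0)
    fix R assume "R \<in> I" "c R \<noteq> 0"
    then show "E R div int b \<noteq> k"
      using that K[of R] E[of R] \<open>b > 0\<close> by (auto simp: pos_imp_zdiv_neg_iff)
  qed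
  have z: "\<bar>z k\<bar> \<le> 2 * H - 1" for k
  proof -
    \<comment> \<open>The origin of the margin 3: a coefficient sum of at most
      \<open>2 * H - 3\<close> bounds the carry by \<open>H - 1\<close>, and together with a
      remainder of at most \<open>H\<close> the digit stays within \<open>2 * H - 1\<close>.\<close>
    have "2 * \<bar>high H (?y (k - 1))\<bar> \<le> (\<Sum>R\<in>I. \<bar>c R\<bar>) + 1"
      using block_sum_bound[OF \<open>b > 0\<close>] by (intro abs_high_le H) (simp add: H_def)
    moreover have "\<bar>low H (?y k)\<bar> \<le> H" using H by (intro abs_low_le)
    ultimately show ?thesis
      using W unfolding z_def carried_def H_def[symmetric] H(2)[symmetric] by linarith
  qed
  have "(\<Sum>R\<in>I. c R * 2 ^ nat (E R)) = (\<Sum>k<K. ?y (int k) * (2 * H) ^ k)"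
    unfolding H using assms(1,2)
  proof (rule sum_blocks)
    show "0 \<le> E R \<and> E R div int b < int K" if "R \<in> I" "c R \<noteq> 0" for R
      using K[of R] E[of R] that by auto
  qed
  also have "\<dots> = (\<Sum>k<K. z (int k) * (2 * H) ^ k)"
    using sum_carried[OF H(1), of ?y K] y0[of "-1"] y0[of "int K - 1"] H(1)
    by (simp add: z_def H_def)
  finally have S: "(\<Sum>R\<in>I. c R * 2 ^ nat (E R)) = (\<Sum>k<K. z (int k) * (2 * H) ^ k)" .
  have "z (int k) = 0" if "k \<ge> K" for k
    using that y0[of "int k"] y0[of "int k - 1"] H by (simp add: z_def carried_def H_def)
  then show ?thesis unfolding S by (intro digit_sum_neg_iff z)
qed

text \<open>A digit can be nonzero only in a block containing an index with nonzero coefficient, or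
  in the block just above, reached by its carry.\<close>

lemma carried_block_sum_support:
  assumes "carried (2 ^ (b - 1)) (block_sum I c E b) k \<noteq> 0"
  shows "\<exists>R\<in>I. c R \<noteq> 0 \<and> (\<exists>j<2::nat. k = E R div int b + int j)"
proof (rule ccontr)
  assume none: "\<not> ?thesis"
  have "E R div int b \<noteq> k \<and> E R div int b \<noteq> k - 1" if "R \<in> I" "c R \<noteq> 0" for R
  proof -
    have "k \<noteq> E R div int b + int 0" "k \<noteq> E R div int b + int 1"
      using none that by (metis zero_less_numeral, metis one_less_numeral_iff semiring_norm(76))
    then show ?thesis by auto
  qed
  then have "block_sum I c E b k = 0" "block_sum I c E b (k - 1) = 0"
    by (auto intro!: block_sum_eq_0)
  then show False using assms by (simp add: carried_def)
qed

section \<open>Computing with residues and gaps of exponents\<close>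

text \<open>The exponents \<open>E R\<close> are only accessible through \<open>r R i\<close>, telling whether \<open>E R mod b = i\<close>,
  and \<open>g R R' t\<close>, telling whether \<open>E R div b\<close> exceeds \<open>E R' div b\<close> by at least \<open>t\<close>.\<close>

definition represents ::
    "nat \<Rightarrow> (nat \<Rightarrow> int) \<Rightarrow> nat set \<Rightarrow> (nat \<Rightarrow> nat \<Rightarrow> bool) \<Rightarrow> (nat \<Rightarrow> nat \<Rightarrow> nat \<Rightarrow> bool) \<Rightarrow> bool" where
  "represents b E A r g \<longleftrightarrow>
     (\<forall>R\<in>A. \<forall>i<b. r R i \<longleftrightarrow> E R mod int b = int i) \<and>
     (\<forall>R\<in>A. \<forall>R'\<in>A. \<forall>t\<le>2. g R R' t \<longleftrightarrow> E R' div int b + int t \<le> E R div int b)"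

text \<open>\<open>block_at g R j R'\<close> means that the block of \<open>R'\<close> is \<open>j - 1\<close> blocks above that of \<open>R\<close>.\<close>

definition block_at :: "(nat \<Rightarrow> nat \<Rightarrow> nat \<Rightarrow> bool) \<Rightarrow> nat \<Rightarrow> nat \<Rightarrow> nat \<Rightarrow> bool" where
  "block_at g R j R' \<longleftrightarrow>
     (if j = 0 then g R R' 1 \<and> \<not> g R R' 2 else g R' R (j - 1) \<and> \<not> g R' R j)"

text \<open>Computes \<open>block_sum\<close> at block \<open>E R div b + j - 1\<close> without
  access to \<open>E\<close>. Splitting by the residue \<open>i\<close> turns the weight
  \<open>2 ^ i\<close> into a constant.\<close>

definition local_sum :: "nat \<Rightarrow> nat \<Rightarrow> (nat \<Rightarrow> int) \<Rightarrow> (nat \<Rightarrow> nat \<Rightarrow> bool) \<Rightarrow>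
    (nat \<Rightarrow> nat \<Rightarrow> nat \<Rightarrow> bool) \<Rightarrow> nat \<Rightarrow> nat \<Rightarrow> int" where
  "local_sum N b c r g R j =
     (\<Sum>R'<N. \<Sum>i<b. 2 ^ i * (c R' * of_bool (block_at g R j R' \<and> r R' i)))"

definition local_digit :: "nat \<Rightarrow> nat \<Rightarrow> (nat \<Rightarrow> int) \<Rightarrow> (nat \<Rightarrow> nat \<Rightarrow> bool) \<Rightarrow>
    (nat \<Rightarrow> nat \<Rightarrow> nat \<Rightarrow> bool) \<Rightarrow> nat \<Rightarrow> nat \<Rightarrow> int" where
  "local_digit N b c r g R j = low (2 ^ (b - 1)) (local_sum N b c r g R (Suc j))
     + high (2 ^ (b - 1)) (local_sum N b c r g R j)"

text \<open>The pair \<open>(R, j)\<close> names position \<open>E R div b + j\<close>. Position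
  \<open>(R', j')\<close> lies strictly above it iff the gap from \<open>R\<close> to
  \<open>R'\<close> is at least \<open>j + 1 - j'\<close>, which ranges over 0, 1, 2 without
  truncation. The predicate \<open>a\<close> selects the nodes whose data may be consulted.\<close>

definition leading_neg :: "nat \<Rightarrow> nat \<Rightarrow> (nat \<Rightarrow> int) \<Rightarrow> (nat \<Rightarrow> bool) \<Rightarrow> (nat \<Rightarrow> nat \<Rightarrow> bool) \<Rightarrow>
    (nat \<Rightarrow> nat \<Rightarrow> nat \<Rightarrow> bool) \<Rightarrow> bool" where
  "leading_neg N b c a r g \<longleftrightarrow> (\<exists>R\<in>{..<N}. \<exists>j\<in>{..<2}. a R \<and> local_digit N b c r g R j < 0 \<and>
     (\<forall>R'\<in>{..<N}. \<forall>j'\<in>{..<2}. a R' \<and> g R' R (j + 1 - j') \<longrightarrow> local_digit N b c r g R' j' = 0))"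

lemma block_at_iff:
  assumes "represents b E A r g" "R \<in> A" "R' \<in> A" "j \<le> 2"
  shows "block_at g R j R' \<longleftrightarrow> E R' div int b = E R div int b + int j - 1"
  using assms unfolding represents_def block_at_def by (auto simp: of_nat_diff)

lemma local_sum_eq:
  assumes rep: "represents b E A r g" and "b > 0" "R \<in> A" "j \<le> 2"
    and c: "\<And>R. R < N \<Longrightarrow> c R \<noteq> 0 \<Longrightarrow> R \<in> A"
  shows "local_sum N b c r g R j = block_sum {..<N} c E b (E R div int b + int j - 1)"
  unfolding local_sum_def block_sum_def
proof (intro sum.cong refl)
  fix R' assume "R' \<in> {..<N}"
  show "(\<Sum>i<b. 2 ^ i * (c R' * of_bool (block_at g R j R' \<and> r R' i))) =
    c R' * of_bool (E R' div int b = E R div int b + int j - 1) * 2 ^ nat (E R' mod int b)"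
  proof (cases "c R' = 0")
    case False
    then have "R' \<in> A" using c \<open>R' \<in> {..<N}\<close> by auto
    define i where "i = nat (E R' mod int b)"
    have i: "i < b" "E R' mod int b = int i"
      using \<open>b > 0\<close> by (auto simp: i_def nat_less_iff)
    have "(\<Sum>i<b. 2 ^ i * (c R' * of_bool (block_at g R j R' \<and> r R' i))) =
        (\<Sum>k<b. if k = i then 2 ^ i * (c R' * of_bool (block_at g R j R')) else 0)"
      using rep \<open>R' \<in> A\<close> i unfolding represents_def by (intro sum.cong) auto
    then show ?thesis
      using i(1) block_at_iff[OF rep \<open>R \<in> A\<close> \<open>R' \<in> A\<close> \<open>j \<le> 2\<close>] by (simp add: i_def)
  qed simp
qed

text \<open>Block positions may be astronomically large, but every nonzero digit sits at a position
  named by some \<open>(R, j)\<close> with \<open>a R\<close>. Hence the search over polynomially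
  many pairs finds the leading digit.\<close>

lemma leading_neg_iff:
  assumes rep: "represents b E A r g" and b: "b > 0" and nonneg: "\<And>R. R \<in> A \<Longrightarrow> 0 \<le> E R"
    and a: "\<And>R. R < N \<Longrightarrow> a R \<Longrightarrow> R \<in> A"
    and c: "\<And>R. R < N \<Longrightarrow> c R \<noteq> 0 \<Longrightarrow> a R"
    and W: "(\<Sum>R<N. \<bar>c R\<bar>) + 3 \<le> 2 ^ b"
  shows "leading_neg N b c a r g \<longleftrightarrow> (\<Sum>R<N. c R * 2 ^ nat (E R)) < 0"
proof -
  define z where "z = carried (2 ^ (b - 1)) (block_sum {..<N} c E b)"
  define q where "q R = E R div int b" for R
  have digit: "local_digit N b c r g R j = z (q R + int j)" if "R < N" "a R" "j < 2" for R j
    using local_sum_eq[OF rep b a[OF that(1,2)], of "Suc j" N c]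
      local_sum_eq[OF rep b a[OF that(1,2)], of j N c] a c that(3)
    by (simp add: local_digit_def z_def carried_def q_def algebra_simps)
  have g: "g R' R (j + 1 - j') \<longleftrightarrow> q R + int j < q R' + int j'"
    if "R < N" "a R" "j < 2" "R' < N" "a R'" "j' < 2" for R j R' j'
    using rep a[OF that(1,2)] a[OF that(4,5)] that(3,6)
    by (auto simp: represents_def q_def of_nat_diff)
  have support: "\<exists>R<N. \<exists>j<2. a R \<and> k = q R + int j" if "z k \<noteq> 0" for k
    using carried_block_sum_support[OF that[unfolded z_def]] c unfolding q_def by blast
  have q: "q R \<ge> 0" if "R < N" "a R" for R
    using nonneg[OF a[OF that]] b by (simp add: q_def pos_imp_zdiv_nonneg_iff)
  have "leading_neg N b c a r g \<longleftrightarrow> (\<exists>k. z (int k) < 0 \<and> (\<forall>k' > k. z (int k') = 0))"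
  proof
    assume "leading_neg N b c a r g"
    then obtain R j where R: "R < N" "j < 2" "a R" "z (q R + int j) < 0" and
      above: "\<And>R' j'. R' < N \<Longrightarrow> j' < 2 \<Longrightarrow> a R' \<Longrightarrow> q R + int j < q R' + int j' \<Longrightarrow>
        z (q R' + int j') = 0"
      unfolding leading_neg_def using digit g by auto
    define k where "k = nat (q R + int j)"
    have k: "int k = q R + int j" using q[of R] R by (simp add: k_def)
    have "z (int k') = 0" if "k' > k" for k'
      using support[of "int k'"] above that k by (metis of_nat_less_iff)
    then show "\<exists>k. z (int k) < 0 \<and> (\<forall>k' > k. z (int k') = 0)" using R(4) k by metis
  next
    assume "\<exists>k. z (int k) < 0 \<and> (\<forall>k' > k. z (int k') = 0)"
    then obtain k where k: "z (int k) < 0" "\<forall>k' > k. z (int k') = 0" by blast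
    then obtain R j where R: "R < N" "j < 2" "a R" "int k = q R + int j"
      using support[of "int k"] by auto
    have "z (q R' + int j') = 0"
      if "R' < N" "j' < 2" "a R'" "q R + int j < q R' + int j'" for R' j'
      using k(2) R(4) that q[of R'] by (metis add_nonneg_nonneg of_nat_0_le_iff of_nat_less_iff zero_le_imp_eq_int)
    then show "leading_neg N b c a r g"
      unfolding leading_neg_def
      using R k(1) digit g by (intro bexI[of _ R] bexI[of _ j] conjI ballI impI) auto
  qed
  also have "\<dots> \<longleftrightarrow> (\<Sum>R<N. c R * 2 ^ nat (E R)) < 0"
    unfolding z_def using b a c nonneg W by (intro sum_neg_iff_leading_digit[symmetric]) auto
  finally show ?thesis .
qed

section \<open>One round: new residues and gaps from those of the successors\<close>

definition exponent_sum :: "nat \<Rightarrow> (nat \<Rightarrow> nat \<Rightarrow> int) \<Rightarrow> (nat \<Rightarrow> int) \<Rightarrow> nat \<Rightarrow> int" where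
  "exponent_sum n d E P = (\<Sum>R<n. d P R * 2 ^ nat (E R))"

text \<open>Index \<open>n + 2\<close> is an additional node with exponent \<open>0\<close>; it is used to represent the
  constant \<open>u\<close>.\<close>

definition diff_coeff :: "nat \<Rightarrow> (nat \<Rightarrow> nat \<Rightarrow> int) \<Rightarrow> nat \<Rightarrow> nat \<Rightarrow> int \<Rightarrow> nat \<Rightarrow> int" where
  "diff_coeff n d P Q u R = d P R - d Q R - (if R = n + 2 then u else 0)"

definition diff_less :: "nat \<Rightarrow> nat \<Rightarrow> (nat \<Rightarrow> nat \<Rightarrow> int) \<Rightarrow> (nat \<Rightarrow> nat \<Rightarrow> bool) \<Rightarrow>
    (nat \<Rightarrow> nat \<Rightarrow> nat \<Rightarrow> bool) \<Rightarrow> nat \<Rightarrow> nat \<Rightarrow> int \<Rightarrow> bool" where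
  "diff_less n b d r g P Q u \<longleftrightarrow> leading_neg (n + 3) b (diff_coeff n d P Q u)
     (\<lambda>R. R = n + 2 \<or> d P R \<noteq> 0 \<or> d Q R \<noteq> 0) r g"

text \<open>As node \<open>n + 2\<close> has exponent 0, \<open>\<not> g R (n + 2) 1\<close> says
  that \<open>E R < b\<close>, and then the residue \<open>i\<close> is the exponent itself.
  Summands with exponent at least \<open>\<beta>\<close> vanish modulo
  \<open>2 ^ \<beta>\<close>.\<close>

definition residue_sum :: "nat \<Rightarrow> nat \<Rightarrow> (nat \<Rightarrow> nat \<Rightarrow> int) \<Rightarrow> (nat \<Rightarrow> nat \<Rightarrow> bool) \<Rightarrow>
    (nat \<Rightarrow> nat \<Rightarrow> nat \<Rightarrow> bool) \<Rightarrow> nat \<Rightarrow> int" where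
  "residue_sum n \<beta> d r g P =
     (\<Sum>R<n. \<Sum>i<\<beta>. 2 ^ i * (d P R * of_bool (r R i \<and> \<not> g R (n + 2) 1)))"

definition next_residue :: "nat \<Rightarrow> nat \<Rightarrow> (nat \<Rightarrow> nat \<Rightarrow> int) \<Rightarrow> (nat \<Rightarrow> nat \<Rightarrow> bool) \<Rightarrow>
    (nat \<Rightarrow> nat \<Rightarrow> nat \<Rightarrow> bool) \<Rightarrow> nat \<Rightarrow> nat \<Rightarrow> bool" where
  "next_residue n \<beta> d r g P i \<longleftrightarrow> residue_sum n \<beta> d r g P mod 2 ^ \<beta> = int i"

text \<open>With \<open>i = e(Q) mod b\<close>, the quotient of \<open>e(P)\<close> is at least that
  of \<open>e(Q)\<close> plus \<open>t\<close> iff \<open>e(P) >= e(Q) - i + t * b\<close>. The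
  disjunction looks up \<open>i\<close>, so that each sign test involves a constant.\<close>

definition next_gap :: "nat \<Rightarrow> nat \<Rightarrow> (nat \<Rightarrow> nat \<Rightarrow> int) \<Rightarrow> (nat \<Rightarrow> nat \<Rightarrow> bool) \<Rightarrow>
    (nat \<Rightarrow> nat \<Rightarrow> nat \<Rightarrow> bool) \<Rightarrow> nat \<Rightarrow> nat \<Rightarrow> nat \<Rightarrow> bool" where
  "next_gap n \<beta> d r g P Q t \<longleftrightarrow> (\<exists>i\<in>{..<2 ^ \<beta>}. next_residue n \<beta> d r g Q i \<and>
     \<not> diff_less n (2 ^ \<beta>) d r g P Q (int t * 2 ^ \<beta> - int i))"

text \<open>Rows \<open>n\<close> and \<open>n + 1\<close> are for the two markings, and row
  \<open>n + 2\<close> is the node of exponent 0; none of them is a successor. In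
  \<open>block_size\<close>, \<open>2 * n\<close> bounds the difference of two rows,
  \<open>2 * 2 ^ \<beta>\<close> the constant \<open>u\<close>, and 3 is the margin for the
  carry.\<close>

locale succ_matrix =
  fixes n \<beta> :: nat and d :: "nat \<Rightarrow> nat \<Rightarrow> int"
  assumes entries: "\<And>P R. \<bar>d P R\<bar> \<le> 1"
    and columns: "\<And>P R. R \<ge> n \<Longrightarrow> d P R = 0"
    and last_row: "\<And>R. d (n + 2) R = 0"
    and block_size: "2 * int n + 2 * 2 ^ \<beta> + 3 \<le> 2 ^ (2 ^ \<beta>)"
begin

abbreviation b :: nat where "b \<equiv> 2 ^ \<beta>"

lemma sum_diff_coeff: "(\<Sum>R<n + 3. \<bar>diff_coeff n d P Q u R\<bar>) \<le> 2 * int n + \<bar>u\<bar>"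
proof -
  have "(\<Sum>R<n + 3. \<bar>diff_coeff n d P Q u R\<bar>) \<le> (\<Sum>R<n. 2) + \<bar>u\<bar>"
  proof -
    have "(\<Sum>R<n. \<bar>diff_coeff n d P Q u R\<bar>) \<le> (\<Sum>R<n. 2)"
    proof (rule sum_mono)
      fix R assume "R \<in> {..<n}"
      then show "\<bar>diff_coeff n d P Q u R\<bar> \<le> 2"
        using entries[of P R] entries[of Q R] by (auto simp: diff_coeff_def)
    qed
    then show ?thesis by (simp add: numeral_3_eq_3 diff_coeff_def columns)
  qed
  then show ?thesis by simp
qed

lemma diff_less_iff:
  assumes rep: "represents b E (insert (n + 2) A) r g" and nonneg: "\<And>R. R \<in> A \<Longrightarrow> 0 \<le> E R"
    and "E (n + 2) = 0" and children: "\<And>R. d P R \<noteq> 0 \<Longrightarrow> R \<in> A" "\<And>R. d Q R \<noteq> 0 \<Longrightarrow> R \<in> A"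
    and u: "\<bar>u\<bar> \<le> 2 * int b"
  shows "diff_less n b d r g P Q u \<longleftrightarrow> exponent_sum n d E P - exponent_sum n d E Q < u"
proof -
  have "diff_less n b d r g P Q u \<longleftrightarrow> (\<Sum>R<n + 3. diff_coeff n d P Q u R * 2 ^ nat (E R)) < 0"
    unfolding diff_less_def
  proof (rule leading_neg_iff[OF rep])
    show "(\<Sum>R<n + 3. \<bar>diff_coeff n d P Q u R\<bar>) + 3 \<le> 2 ^ b"
      using sum_diff_coeff[of P Q u] u block_size by simp
    show "R = n + 2 \<or> d P R \<noteq> 0 \<or> d Q R \<noteq> 0" if "diff_coeff n d P Q u R \<noteq> 0" for R
      using that by (auto simp: diff_coeff_def split: if_splits)
    show "0 \<le> E R" if "R \<in> insert (n + 2) A" for R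
      using that nonneg assms(3) by auto
  qed (use children in auto)
  also have "(\<Sum>R<n + 3. diff_coeff n d P Q u R * 2 ^ nat (E R)) =
      exponent_sum n d E P - exponent_sum n d E Q - u"
    using assms(3)
    by (simp add: numeral_3_eq_3 diff_coeff_def columns exponent_sum_def left_diff_distrib sum_subtractf)
  finally show ?thesis by simp
qed

lemma residue_sum_cong:
  assumes rep: "represents b E (insert (n + 2) A) r g" and nonneg: "\<And>R. R \<in> A \<Longrightarrow> 0 \<le> E R"
    and "E (n + 2) = 0" and children: "\<And>R. d P R \<noteq> 0 \<Longrightarrow> R \<in> A"
  shows "residue_sum n \<beta> d r g P mod 2 ^ \<beta> = exponent_sum n d E P mod 2 ^ \<beta>"
proof -
  have "2 ^ \<beta> dvd (\<Sum>i<\<beta>. 2 ^ i * (d P R * of_bool (r R i \<and> \<not> g R (n + 2) 1)))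
      - d P R * 2 ^ nat (E R)" for R
  proof (cases "d P R = 0")
    case False
    then have R: "R \<in> A" by (rule children)
    have "\<beta> < b" by simp
    have r: "r R i \<longleftrightarrow> E R mod int b = int i" if "i < \<beta>" for i
      using rep R that \<open>\<beta> < b\<close> unfolding represents_def by (metis insertI2 less_trans)
    have "g R (n + 2) 1 \<longleftrightarrow> 1 \<le> E R div int b"
      using rep R \<open>E (n + 2) = 0\<close> unfolding represents_def by auto
    then have g: "\<not> g R (n + 2) 1 \<longleftrightarrow> E R < int b"
      using pos_imp_zdiv_pos_iff[of "int b" "E R"] by fastforce
    have eq: "r R i \<and> \<not> g R (n + 2) 1 \<longleftrightarrow> i = nat (E R)" if "i < \<beta>" for i
    proof
      assume "r R i \<and> \<not> g R (n + 2) 1"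
      then have "E R mod int b = int i" "E R < int b" using r[OF that] g by auto
      then show "i = nat (E R)" using nonneg[OF R] by simp
    next
      assume "i = nat (E R)"
      then have "E R = int i" using nonneg[OF R] by simp
      moreover have "int i < int b" using that \<open>\<beta> < b\<close> by linarith
      ultimately show "r R i \<and> \<not> g R (n + 2) 1" using r[OF that] g by simp
    qed
    have "(\<Sum>i<\<beta>. 2 ^ i * (d P R * of_bool (r R i \<and> \<not> g R (n + 2) 1))) =
        (\<Sum>i<\<beta>. if i = nat (E R) then d P R * 2 ^ nat (E R) else 0)"
    proof (intro sum.cong refl)
      fix i assume "i \<in> {..<\<beta>}"
      then have "i < \<beta>" by simp
      then show "2 ^ i * (d P R * of_bool (r R i \<and> \<not> g R (n + 2) 1)) =
          (if i = nat (E R) then d P R * 2 ^ nat (E R) else 0)"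
        unfolding eq[OF \<open>i < \<beta>\<close>] by simp
    qed
    also have "\<dots> = (if nat (E R) < \<beta> then d P R * 2 ^ nat (E R) else 0)" by simp
    finally show ?thesis by (auto simp: not_less intro!: dvd_mult le_imp_power_dvd)
  qed simp
  then have "2 ^ \<beta> dvd residue_sum n \<beta> d r g P - exponent_sum n d E P"
    unfolding residue_sum_def exponent_sum_def sum_subtractf[symmetric] by (intro dvd_sum)
  then show ?thesis by (simp add: mod_eq_dvd_iff)
qed

lemma next_residue_iff:
  assumes "represents b E (insert (n + 2) A) r g" "\<And>R. R \<in> A \<Longrightarrow> 0 \<le> E R"
    and "E (n + 2) = 0" "\<And>R. d P R \<noteq> 0 \<Longrightarrow> R \<in> A"
  shows "next_residue n \<beta> d r g P i \<longleftrightarrow> exponent_sum n d E P mod int b = int i"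
  using residue_sum_cong[OF assms] by (simp add: next_residue_def)

lemma next_gap_iff:
  assumes rep: "represents b E (insert (n + 2) A) r g" and nonneg: "\<And>R. R \<in> A \<Longrightarrow> 0 \<le> E R"
    and "E (n + 2) = 0" and children: "\<And>R. d P R \<noteq> 0 \<Longrightarrow> R \<in> A" "\<And>R. d Q R \<noteq> 0 \<Longrightarrow> R \<in> A"
    and t: "t \<le> 2"
  shows "next_gap n \<beta> d r g P Q t \<longleftrightarrow>
    exponent_sum n d E Q div int b + int t \<le> exponent_sum n d E P div int b"
proof -
  let ?P = "exponent_sum n d E P" and ?Q = "exponent_sum n d E Q"
  define i where "i = nat (?Q mod int b)"
  have i: "?Q mod int b = int i" "i < b"
    by (auto simp: i_def nat_less_iff)
  have t': "0 \<le> int t * int b" "int t * int b \<le> 2 * int b" using t by (auto intro: mult_right_mono)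
  have "int i < int b" using i(2) by linarith
  then have "\<bar>int t * int b - int i\<bar> \<le> 2 * int b" using t' by linarith
  then have less: "diff_less n b d r g P Q (int t * int b - int i) \<longleftrightarrow> ?P - ?Q < int t * int b - int i"
    by (intro diff_less_iff[OF rep nonneg assms(3) children])
  have "next_residue n \<beta> d r g Q k \<longleftrightarrow> k = i" for k
    using next_residue_iff[OF rep nonneg assms(3) children(2), of _ k] i(1) by auto
  then have "next_gap n \<beta> d r g P Q t \<longleftrightarrow> \<not> diff_less n b d r g P Q (int t * int b - int i)"
    unfolding next_gap_def using i(2) by auto
  also have "\<dots> \<longleftrightarrow> (?Q div int b + int t) * int b \<le> ?P"
    using less i(1) div_mult_mod_eq[of ?Q "int b"] by (auto simp: algebra_simps)
  also have "\<dots> \<longleftrightarrow> ?Q div int b + int t \<le> ?P div int b"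
  proof
    assume "(?Q div int b + int t) * int b \<le> ?P"
    then have "(?Q div int b + int t) * int b div int b \<le> ?P div int b"
      by (intro zdiv_mono1) auto
    then show "?Q div int b + int t \<le> ?P div int b" by simp
  next
    assume "?Q div int b + int t \<le> ?P div int b"
    then have "(?Q div int b + int t) * int b \<le> ?P div int b * int b" by (intro mult_right_mono) auto
    also have "\<dots> \<le> ?P"
      using div_mult_mod_eq[of ?P "int b"] pos_mod_sign[of "int b" ?P] \<open>int i < int b\<close> by linarith
    finally show "(?Q div int b + int t) * int b \<le> ?P" .
  qed
  finally show ?thesis .
qed

end

text \<open>The initial data are those of exponent 0, hence right for node \<open>n + 2\<close>;
  nothing is claimed about any other node before the round count exceeds its height.\<close>

primrec states :: "nat \<Rightarrow> nat \<Rightarrow> (nat \<Rightarrow> nat \<Rightarrow> int) \<Rightarrow> nat \<Rightarrow>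
    (nat \<Rightarrow> nat \<Rightarrow> bool) \<times> (nat \<Rightarrow> nat \<Rightarrow> nat \<Rightarrow> bool)" where
  "states n \<beta> d 0 = (\<lambda>P i. i = 0, \<lambda>P Q t. t = 0)"
| "states n \<beta> d (Suc h) =
     (next_residue n \<beta> d (fst (states n \<beta> d h)) (snd (states n \<beta> d h)),
      next_gap n \<beta> d (fst (states n \<beta> d h)) (snd (states n \<beta> d h)))"

text \<open>States that no walk of \<open>h\<close> edges starts at \<open>P\<close>, that is, round
  \<open>h\<close> has reached \<open>P\<close>. The base case is false because the empty walk
  always exists.\<close>

primrec no_walk :: "nat \<Rightarrow> (nat \<Rightarrow> nat \<Rightarrow> int) \<Rightarrow> nat \<Rightarrow> nat \<Rightarrow> bool" where
  "no_walk n d 0 P \<longleftrightarrow> False"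
| "no_walk n d (Suc h) P \<longleftrightarrow> (\<forall>Q\<in>{..<n}. d P Q \<noteq> 0 \<longrightarrow> no_walk n d h Q)"

context succ_matrix
begin

text \<open>\<open>E\<close> is given beforehand as a solution of the exponent equations on a
  successor-closed set \<open>A\<close>. Allowing any such \<open>A\<close> makes the lemma usable
  before all nodes are known to be valid.\<close>

lemma represents_states:
  assumes nonneg: "\<And>R. R \<in> A \<Longrightarrow> 0 \<le> E R"
    and E: "\<And>R. R \<in> A \<Longrightarrow> E R = exponent_sum n d E R" and z: "E (n + 2) = 0"
    and closed: "\<And>R S. R \<in> A \<Longrightarrow> d R S \<noteq> 0 \<Longrightarrow> S \<in> A"
  shows "represents b E (insert (n + 2) {R \<in> A. no_walk n d h R})
    (fst (states n \<beta> d h)) (snd (states n \<beta> d h))"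
proof (induction h)
  case 0
  then show ?case using z by (auto simp: represents_def)
next
  case (Suc h)
  let ?A = "{R \<in> A. no_walk n d h R}"
  have eval: "E R = exponent_sum n d E R \<and> (\<forall>S. d R S \<noteq> 0 \<longrightarrow> S \<in> ?A)"
    if "R \<in> insert (n + 2) {R \<in> A. no_walk n d (Suc h) R}" for R
  proof (cases "R = n + 2")
    case True
    then show ?thesis using z last_row unfolding True exponent_sum_def by simp
  next
    case False
    then have R: "R \<in> A" "no_walk n d (Suc h) R" using that by auto
    then have "S \<in> ?A" if "d R S \<noteq> 0" for S
      using that closed[OF R(1) that] columns[of S R] by (cases "S < n") auto
    then show ?thesis using E[OF R(1)] by blast
  qed
  have nonneg': "\<And>R. R \<in> ?A \<Longrightarrow> 0 \<le> E R" using nonneg by auto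
  show ?case
    unfolding represents_def states.simps fst_conv snd_conv
  proof (intro conjI ballI allI impI)
    fix R i assume "R \<in> insert (n + 2) {R \<in> A. no_walk n d (Suc h) R}"
    from eval[OF this] show "next_residue n \<beta> d (fst (states n \<beta> d h)) (snd (states n \<beta> d h)) R i
        \<longleftrightarrow> E R mod int b = int i"
      by (subst next_residue_iff[OF Suc.IH nonneg' z]) auto
  next
    fix R R' and t :: nat assume "R \<in> insert (n + 2) {R \<in> A. no_walk n d (Suc h) R}"
      "R' \<in> insert (n + 2) {R \<in> A. no_walk n d (Suc h) R}" "t \<le> 2"
    then show "next_gap n \<beta> d (fst (states n \<beta> d h)) (snd (states n \<beta> d h)) R R' t
        \<longleftrightarrow> E R' div int b + int t \<le> E R div int b"
      using eval[of R] eval[of R'] by (subst next_gap_iff[OF Suc.IH nonneg' z]) auto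
  qed
qed

lemma diff_less_states:
  assumes "\<And>R. R \<in> A \<Longrightarrow> 0 \<le> E R"
    and "\<And>R. R \<in> A \<Longrightarrow> E R = exponent_sum n d E R" and "E (n + 2) = 0"
    and "\<And>R S. R \<in> A \<Longrightarrow> d R S \<noteq> 0 \<Longrightarrow> S \<in> A"
    and "\<And>R. R \<in> A \<Longrightarrow> no_walk n d h R"
    and "\<And>R. d P R \<noteq> 0 \<Longrightarrow> R \<in> A" "\<And>R. d Q R \<noteq> 0 \<Longrightarrow> R \<in> A"
  shows "diff_less n b d (fst (states n \<beta> d h)) (snd (states n \<beta> d h)) P Q 0
    \<longleftrightarrow> exponent_sum n d E P < exponent_sum n d E Q"
proof -
  have "{R \<in> A. no_walk n d h R} = A" using assms(5) by auto
  then have "represents b E (insert (n + 2) A) (fst (states n \<beta> d h)) (snd (states n \<beta> d h))"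
    using represents_states[where h = h, OF assms(1-4)] by simp
  then have "diff_less n b d (fst (states n \<beta> d h)) (snd (states n \<beta> d h)) P Q 0
      \<longleftrightarrow> exponent_sum n d E P - exponent_sum n d E Q < 0"
    by (rule diff_less_iff) (use assms in auto)
  then show ?thesis by simp
qed

end

section \<open>Constant-depth threshold formulas for one round\<close>

lemma tform_imp:
  assumes "2 \<le> m" "tform F m d f" "tform F m d g"
  shows "tform F m (d + 2) (\<lambda>x. f x \<longrightarrow> g x)"
proof -
  have "tform F m (Suc (Suc d)) (\<lambda>x. \<not> f x \<or> g x)"
    using assms by (intro tform_disj tform_Not tform_mono[OF assms(3)]) simp_all
  then show ?thesis by (simp only: imp_conv_disj add_2_eq_Suc')
qed

lemma unary_sum_const: "unary_sum F m (Suc d) (nat \<bar>u\<bar>) (\<lambda>x. u)"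
proof -
  have "unary_sum F m (Suc d) (nat \<bar>u\<bar> * 1) (\<lambda>x. u * of_bool True)"
    by (intro unary_sum_cmult unary_sum_of_bool tform_const)
  then show ?thesis by simp
qed

text \<open>Unary length of a block sum: \<open>n + 3\<close> nodes, \<open>b\<close> residues,
  weights up to \<open>2 ^ b\<close>, and coefficients of length \<open>4 + 2 * b\<close> (two
  matrix entries of length 2 and a constant of absolute value at most \<open>2 * b\<close>).\<close>

definition sum_bound :: "nat \<Rightarrow> nat \<Rightarrow> nat" where
  "sum_bound n b = (n + 3) * (b * (2 ^ b * (4 + 2 * b)))"

lemma unary_sum_weighted:
  assumes "2 \<le> m" and p: "\<And>R i. R \<in> I \<Longrightarrow> i < l \<Longrightarrow> tform F m d (\<lambda>x. p x R i)"
    and c: "\<And>R. R \<in> I \<Longrightarrow> unary_sum F m d k (\<lambda>x. c x R)"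
  shows "unary_sum F m (Suc d) (card I * (l * (2 ^ l * k)))
    (\<lambda>x. \<Sum>R\<in>I. \<Sum>i<l. 2 ^ i * (c x R * of_bool (p x R i)))"
proof (rule unary_sum_sum)
  fix R assume R: "R \<in> I"
  have "unary_sum F m (Suc d) (card {..<l} * (2 ^ l * k))
      (\<lambda>x. \<Sum>i\<in>{..<l}. 2 ^ i * (c x R * of_bool (p x R i)))"
  proof (rule unary_sum_sum)
    fix i assume "i \<in> {..<l}"
    then have "unary_sum F m (Suc d) (nat \<bar>2 ^ i\<bar> * k) (\<lambda>x. 2 ^ i * (c x R * of_bool (p x R i)))"
      using assms(1) p[OF R] c[OF R] by (intro unary_sum_cmult unary_sum_mult_of_bool) auto
    moreover have "nat \<bar>2 ^ i\<bar> * k \<le> 2 ^ l * k"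
      using \<open>i \<in> {..<l}\<close> by (simp add: nat_power_eq)
    ultimately show "unary_sum F m (Suc d) (2 ^ l * k) (\<lambda>x. 2 ^ i * (c x R * of_bool (p x R i)))"
      by (rule unary_sum_mono[OF _ le_refl])
  qed
  then show "unary_sum F m (Suc d) (l * (2 ^ l * k)) (\<lambda>x. \<Sum>i<l. 2 ^ i * (c x R * of_bool (p x R i)))"
    by simp
qed

text \<open>Depth 2 is the cost of decoding a matrix entry from input bits; wires of the previous
  round and constants fit under the same bound.\<close>

locale state_formulas =
  fixes F :: "('x \<Rightarrow> bool) set" and m n \<beta> :: nat and d :: "'x \<Rightarrow> nat \<Rightarrow> nat \<Rightarrow> int"
    and r :: "'x \<Rightarrow> nat \<Rightarrow> nat \<Rightarrow> bool" and g :: "'x \<Rightarrow> nat \<Rightarrow> nat \<Rightarrow> nat \<Rightarrow> bool"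
  assumes entry: "\<And>P R. unary_sum F m 2 2 (\<lambda>x. d x P R)"
    and edge: "\<And>P R. tform F m 2 (\<lambda>x. d x P R \<noteq> 0)"
    and residue: "\<And>R i. R < n + 3 \<Longrightarrow> i < 2 ^ \<beta> \<Longrightarrow> tform F m 2 (\<lambda>x. r x R i)"
    and gap: "\<And>R R' t. R < n + 3 \<Longrightarrow> R' < n + 3 \<Longrightarrow> t \<le> 2 \<Longrightarrow> tform F m 2 (\<lambda>x. g x R R' t)"
    and fan_in: "n + 3 \<le> m" "2 ^ \<beta> \<le> m" "(2 * sum_bound n (2 ^ \<beta>) + 1)\<^sup>2 \<le> m"
begin

abbreviation b :: nat where "b \<equiv> 2 ^ \<beta>"

lemma m_ge_2: "2 \<le> m"
  using fan_in(1) by linarith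

lemma tform_block_at:
  assumes "R < n + 3" "R' < n + 3" "j \<le> 2"
  shows "tform F m 4 (\<lambda>x. block_at (g x) R j R')"
proof -
  have "tform F m (Suc 3) (\<lambda>x. g x S S' t \<and> \<not> g x S S' t')"
    if "S < n + 3" "S' < n + 3" "t \<le> 2" "t' \<le> 2" for S S' t t'
    using tform_Not[OF gap[OF that(1,2,4)]] tform_mono[OF gap[OF that(1,2,3)], of 3] m_ge_2
    by (intro tform_conj) (simp_all add: numeral_eq_Suc)
  then show ?thesis using assms by (cases "j = 0") (simp_all add: block_at_def)
qed

lemma unary_sum_local_sum:
  assumes "R < n + 3" "j \<le> 2" "\<And>R. R < n + 3 \<Longrightarrow> unary_sum F m 2 (4 + 2 * b) (\<lambda>x. c x R)"
  shows "unary_sum F m 6 (sum_bound n b) (\<lambda>x. local_sum (n + 3) b (c x) (r x) (g x) R j)"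
proof -
  have "unary_sum F m (Suc 5) (card {..<n + 3} * (b * (2 ^ b * (4 + 2 * b))))
     (\<lambda>x. \<Sum>R'<n + 3. \<Sum>i<b. 2 ^ i * (c x R' * of_bool (block_at (g x) R j R' \<and> r x R' i)))"
  proof (rule unary_sum_weighted[OF m_ge_2])
    fix R' i assume "R' \<in> {..<n + 3}" "i < b"
    then have "tform F m (Suc 4) (\<lambda>x. block_at (g x) R j R' \<and> r x R' i)"
      using assms(1,2) by (intro tform_conj m_ge_2 tform_block_at tform_mono[OF residue]) auto
    then show "tform F m 5 (\<lambda>x. block_at (g x) R j R' \<and> r x R' i)" by simp
  qed (simp add: unary_sum_mono[OF assms(3)])
  then show ?thesis by (simp add: local_sum_def sum_bound_def)
qed

text \<open>A digit depends on two polynomially bounded unary sums, so one lookup over their pair of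
  values performs remainder, carry, addition and the test \<open>Q\<close> together.\<close>

lemma tform_local_digit:
  assumes "R < n + 3" "j < 2" "\<And>R. R < n + 3 \<Longrightarrow> unary_sum F m 2 (4 + 2 * b) (\<lambda>x. c x R)"
  shows "tform F m 13 (\<lambda>x. Q (local_digit (n + 3) b (c x) (r x) (g x) R j))"
proof -
  have "tform F m (6 + 7) (\<lambda>x. Q (local_digit (n + 3) b (c x) (r x) (g x) R j))"
    unfolding local_digit_def
    using assms(1,2)
    by (intro unary_sum_pred2[where R = "\<lambda>u v. Q (low (2 ^ (b - 1)) u + high (2 ^ (b - 1)) v)",
          OF unary_sum_local_sum[OF _ _ assms(3)] unary_sum_local_sum[OF _ _ assms(3)]
          fan_in(3) m_ge_2]) simp_all
  then show ?thesis by simp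
qed

lemma tform_leading_neg:
  assumes c: "\<And>R. R < n + 3 \<Longrightarrow> unary_sum F m 2 (4 + 2 * b) (\<lambda>x. c x R)"
    and a: "\<And>R. R < n + 3 \<Longrightarrow> tform F m 4 (\<lambda>x. a x R)"
  shows "tform F m 21 (\<lambda>x. leading_neg (n + 3) b (c x) (a x) (r x) (g x))"
proof -
  have guard: "tform F m (Suc 4) (\<lambda>x. a x R' \<and> g x R' R (j + 1 - j'))"
    if "R < n + 3" "j < 2" "R' < n + 3" "j' < 2" for R j R' j'
    using that by (intro tform_conj m_ge_2 a tform_mono[OF gap]) auto
  let ?digit = "\<lambda>x. local_digit (n + 3) b (c x) (r x) (g x)"
  have above: "tform F m 17 (\<lambda>x. \<forall>R'\<in>{..<n + 3}. \<forall>j'\<in>{..<2}.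
      a x R' \<and> g x R' R (j + 1 - j') \<longrightarrow> ?digit x R' j' = 0)" if "R < n + 3" "j < 2" for R j
  proof -
    have "tform F m (13 + 2) (\<lambda>x. a x R' \<and> g x R' R (j + 1 - j') \<longrightarrow> ?digit x R' j' = 0)"
      if "R' < n + 3" "j' < 2" for R' j'
      using guard[OF \<open>R < n + 3\<close> \<open>j < 2\<close> that]
      by (intro tform_imp[OF m_ge_2] tform_local_digit[OF that c]) (auto intro: tform_mono)
    then have "tform F m (Suc (Suc 15)) (\<lambda>x. \<forall>R'\<in>{..<n + 3}. \<forall>j'\<in>{..<2}.
        a x R' \<and> g x R' R (j + 1 - j') \<longrightarrow> ?digit x R' j' = 0)"
      using fan_in(1) m_ge_2 by (intro tform_ball) auto
    then show ?thesis by simp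
  qed
  have "tform F m (Suc (Suc 17)) (\<lambda>x. a x R \<and> ?digit x R j < 0 \<and>
      (\<forall>R'\<in>{..<n + 3}. \<forall>j'\<in>{..<2}. a x R' \<and> g x R' R (j + 1 - j') \<longrightarrow> ?digit x R' j' = 0))"
    if "R < n + 3" "j < 2" for R j
  proof (intro tform_conj[OF m_ge_2] above that)
    show "tform F m (Suc 17) (\<lambda>x. a x R)" using a[OF that(1)] by (rule tform_mono) simp
    show "tform F m 17 (\<lambda>x. ?digit x R j < 0)"
      by (rule tform_mono[OF tform_local_digit[OF that c]]) simp_all
  qed
  then have "tform F m (Suc (Suc (Suc (Suc 17)))) (\<lambda>x. leading_neg (n + 3) b (c x) (a x) (r x) (g x))"
    unfolding leading_neg_def using fan_in m_ge_2 by (intro tform_bex) auto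
  then show ?thesis by simp
qed

lemma tform_diff_less:
  assumes "nat \<bar>u\<bar> \<le> 2 * b"
  shows "tform F m 21 (\<lambda>x. diff_less n b (d x) (r x) (g x) P Q u)"
  unfolding diff_less_def
proof (rule tform_leading_neg)
  fix R
  have "unary_sum F m 2 (2 + 2 + nat \<bar>if R = n + 2 then u else 0\<bar>) (\<lambda>x. diff_coeff n (d x) P Q u R)"
    unfolding diff_coeff_def
    by (intro unary_sum_diff entry unary_sum_mono[OF unary_sum_const[of F m 0]]) auto
  then show "unary_sum F m 2 (4 + 2 * b) (\<lambda>x. diff_coeff n (d x) P Q u R)"
    by (rule unary_sum_mono) (use assms in auto)
  have "tform F m (Suc (Suc 2)) (\<lambda>x. R = n + 2 \<or> d x P R \<noteq> 0 \<or> d x Q R \<noteq> 0)"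
    by (intro tform_disj m_ge_2 edge tform_mono[OF tform_const[of F m 0]]) auto
  then show "tform F m 4 (\<lambda>x. R = n + 2 \<or> d x P R \<noteq> 0 \<or> d x Q R \<noteq> 0)" by simp
qed

lemma tform_next_residue: "tform F m 12 (\<lambda>x. next_residue n \<beta> (d x) (r x) (g x) P i)"
proof -
  have "\<beta> \<le> b" by (rule less_imp_le[OF less_exp])
  have sum: "unary_sum F m (Suc 4) (card {..<n} * (\<beta> * (2 ^ \<beta> * 2)))
     (\<lambda>x. \<Sum>R<n. \<Sum>i<\<beta>. 2 ^ i * (d x P R * of_bool (r x R i \<and> \<not> g x R (n + 2) 1)))"
  proof (rule unary_sum_weighted[OF m_ge_2])
    fix R i assume "R \<in> {..<n}" "i < \<beta>"
    have "i < b" using \<open>i < \<beta>\<close> \<open>\<beta> \<le> b\<close> by (rule less_le_trans)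
    then have "tform F m 3 (\<lambda>x. r x R i)"
      using \<open>R \<in> {..<n}\<close> by (intro tform_mono[OF residue]) simp_all
    moreover have "tform F m (Suc 2) (\<lambda>x. \<not> g x R (n + 2) 1)"
      using \<open>R \<in> {..<n}\<close> by (intro tform_Not gap) simp_all
    ultimately have "tform F m (Suc 3) (\<lambda>x. r x R i \<and> \<not> g x R (n + 2) 1)"
      by (intro tform_conj m_ge_2) simp_all
    then show "tform F m 4 (\<lambda>x. r x R i \<and> \<not> g x R (n + 2) 1)" by simp
  qed (auto intro: unary_sum_mono[OF entry])
  have bound: "card {..<n} * (\<beta> * (2 ^ \<beta> * 2)) \<le> sum_bound n b"
    unfolding sum_bound_def
    using \<open>\<beta> \<le> b\<close> by (intro mult_le_mono power_increasing) simp_all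
  have "unary_sum F m 5 (sum_bound n b) (\<lambda>x. residue_sum n \<beta> (d x) (r x) (g x) P)"
    unfolding residue_sum_def by (rule unary_sum_mono[OF sum _ bound]) simp
  from unary_sum_pred[OF this fan_in(3) m_ge_2, of "\<lambda>v. v mod 2 ^ \<beta> = int i"]
  show ?thesis by (simp add: next_residue_def)
qed

lemma tform_next_gap:
  assumes "t \<le> 2"
  shows "tform F m 24 (\<lambda>x. next_gap n \<beta> (d x) (r x) (g x) P Q t)"
proof -
  have u: "nat \<bar>int t * 2 ^ \<beta> - int i\<bar> \<le> 2 * b" if "i < b" for i
  proof -
    have "int t * 2 ^ \<beta> \<le> 2 * 2 ^ \<beta>" using assms by (intro mult_right_mono) auto
    moreover have "int i \<le> 2 ^ \<beta>" using that by (metis less_imp_le of_nat_less_iff of_nat_numeral of_nat_power)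
    moreover have "0 \<le> int t * 2 ^ \<beta>" by simp
    ultimately have "\<bar>int t * 2 ^ \<beta> - int i\<bar> \<le> 2 * 2 ^ \<beta>" by linarith
    then show ?thesis by (simp add: nat_le_iff)
  qed
  have "tform F m (Suc (Suc 22)) (\<lambda>x. next_gap n \<beta> (d x) (r x) (g x) P Q t)"
    unfolding next_gap_def
  proof (intro tform_bex tform_conj m_ge_2)
    fix i assume "i \<in> {..<b}"
    then show "tform F m 22 (\<lambda>x. \<not> diff_less n b (d x) (r x) (g x) P Q (int t * 2 ^ \<beta> - int i))"
      using tform_Not[OF tform_diff_less[OF u]] by simp
    show "tform F m 22 (\<lambda>x. next_residue n \<beta> (d x) (r x) (g x) Q i)"
      by (rule tform_mono[OF tform_next_residue]) simp
  qed (use fan_in in auto)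
  then show ?thesis by simp
qed

end

section \<open>Encoding\<close>

lemma length_concat_uniform:
  assumes "\<And>i. i < m \<Longrightarrow> length (f i) = l"
  shows "length (concat (map f [0..<m])) = m * l"
  using assms by (induction m) auto

lemma nth_concat_uniform:
  assumes "\<And>i. i < m \<Longrightarrow> length (f i) = l" "i < m" "j < l"
  shows "concat (map f [0..<m]) ! (i * l + j) = f i ! j"
  using assms
proof (induction m)
  case (Suc m)
  have len: "length (concat (map f [0..<m])) = m * l"
    using Suc.prems(1) by (intro length_concat_uniform) auto
  show ?case
  proof (cases "i < m")
    case True
    then have "(i + 1) * l \<le> m * l" by (intro mult_right_mono) auto
    then have "i * l + j < m * l" using Suc.prems(3) by simp
    then show ?thesis using Suc.IH Suc.prems True len by (simp add: nth_append)
  next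
    case False
    then have "i = m" using Suc.prems(2) by simp
    then show ?thesis using len by (simp add: nth_append)
  qed
qed simp

definition instance_row ::
    "nat \<Rightarrow> (nat \<Rightarrow> nat \<Rightarrow> int) \<Rightarrow> (nat \<Rightarrow> int) \<Rightarrow> (nat \<Rightarrow> int) \<Rightarrow> nat \<Rightarrow> nat \<Rightarrow> int" where
  "instance_row n \<delta> L M P = (if P < n then \<delta> P else if P = n then L else M)"

lemma encode_instance_rows:
  "encode_instance n \<delta> L M =
     concat (map (\<lambda>P. encode_marking n (instance_row n \<delta> L M P)) [0..<n + 2])"
proof -
  have "map (\<lambda>P. encode_marking n (instance_row n \<delta> L M P)) [0..<n] =
      map (\<lambda>P. encode_marking n (\<delta> P)) [0..<n]"
    by (simp add: instance_row_def)
  then have "concat (map (\<lambda>P. encode_marking n (instance_row n \<delta> L M P)) [0..<n]) =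
      concat (map (\<lambda>P. encode_marking n (\<delta> P)) [0..<n])" by (rule arg_cong)
  then show ?thesis
    by (simp del: map_eq_conv add: encode_instance_def) (simp add: instance_row_def)
qed

lemma length_encode_marking [simp]: "length (encode_marking n M) = n * 2"
  unfolding encode_marking_def by (rule length_concat_uniform) (simp add: symbol_bits_def)

lemma nth_encode_marking:
  "Q < n \<Longrightarrow> e < 2 \<Longrightarrow> encode_marking n M ! (Q * 2 + e) = symbol_bits (M Q) ! e"
  unfolding encode_marking_def by (rule nth_concat_uniform) (auto simp: symbol_bits_def)

lemma length_encode_instance: "length (encode_instance n \<delta> L M) = (n + 2) * (n * 2)"
  unfolding encode_instance_rows by (rule length_concat_uniform) simp

lemma nth_encode_instance:
  assumes "P < n + 2" "Q < n" "e < 2"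
  shows "encode_instance n \<delta> L M ! (2 * (P * n + Q) + e) = symbol_bits (instance_row n \<delta> L M P Q) ! e"
proof -
  have "Q * 2 + e < n * 2" using assms by simp
  then have "encode_instance n \<delta> L M ! (P * (n * 2) + (Q * 2 + e)) =
      encode_marking n (instance_row n \<delta> L M P) ! (Q * 2 + e)"
    unfolding encode_instance_rows using assms(1) by (intro nth_concat_uniform) auto
  then show ?thesis
    using nth_encode_marking[OF assms(2,3)] by (simp add: algebra_simps)
qed

definition symbol_at :: "bool list \<Rightarrow> nat \<Rightarrow> int" where
  "symbol_at x k = of_bool (x ! (2 * k + 1) \<and> \<not> x ! (2 * k)) - of_bool (x ! (2 * k + 1) \<and> x ! (2 * k))"

text \<open>Rows \<open>n\<close> and \<open>n + 1\<close> hold the two markings to be compared.\<close>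

definition input_matrix :: "nat \<Rightarrow> bool list \<Rightarrow> nat \<Rightarrow> nat \<Rightarrow> int" where
  "input_matrix n x P Q = (if P < n + 2 \<and> Q < n then symbol_at x (P * n + Q) else 0)"

lemma input_matrix_encode:
  assumes "instance_row n \<delta> L M P Q \<in> {-1, 0, 1}" "P < n + 2" "Q < n"
  shows "input_matrix n (encode_instance n \<delta> L M) P Q = instance_row n \<delta> L M P Q"
  using assms nth_encode_instance[OF assms(2,3), of 0 \<delta> L M]
    nth_encode_instance[OF assms(2,3), of 1 \<delta> L M]
  by (auto simp: input_matrix_def symbol_at_def symbol_bits_def)

text \<open>A sign bit without the nonzero bit encodes no symbol, and \<open>symbol_at\<close> would
  silently read that pair as 0.\<close>

definition valid_input :: "nat \<Rightarrow> bool list \<Rightarrow> bool" where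
  "valid_input n x \<longleftrightarrow> (\<forall>k\<in>{..<(n + 2) * n}. x ! (2 * k) \<longrightarrow> x ! (2 * k + 1))"

lemma div_mod_index:
  fixes k m n :: nat
  assumes "k < m * n"
  shows "k div n < m" "k mod n < n" "k = k div n * n + k mod n"
  using assms by (cases "n = 0"; simp add: less_mult_imp_div_less)+

lemma valid_encode_instance:
  shows "valid_input n (encode_instance n \<delta> L M)"
  unfolding valid_input_def
proof (intro ballI impI)
  let ?x = "encode_instance n \<delta> L M"
  fix k assume "k \<in> {..<(n + 2) * n}" "?x ! (2 * k)"
  then show "?x ! (2 * k + 1)"
    using div_mod_index[of k "n + 2" n] nth_encode_instance[of "k div n" n "k mod n" 0 \<delta> L M]
      nth_encode_instance[of "k div n" n "k mod n" 1 \<delta> L M]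
    by (auto simp: symbol_bits_def)
qed

text \<open>Decoding followed by encoding loses nothing on valid words, so an accepted word comes
  with the instance that membership in the language asks for.\<close>

lemma encode_input_matrix:
  assumes len: "length x = (n + 2) * (n * 2)" and valid: "valid_input n x"
  shows "encode_instance n (input_matrix n x) (input_matrix n x n) (input_matrix n x (n + 1)) = x"
    (is "?y = x")
proof (rule nth_equalityI)
  show "length ?y = length x" by (simp add: len length_encode_instance)
next
  fix i assume "i < length ?y"
  then have "i < (n + 2) * (n * 2)" by (simp only: length_encode_instance)
  define k e where "k = i div 2" "e = i mod 2"
  have i: "i = 2 * k + e" "e < 2" by (simp_all add: k_e_def)
  then have k: "k < (n + 2) * n" using \<open>i < (n + 2) * (n * 2)\<close> by simp
  define P Q where "P = k div n" "Q = k mod n"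
  have PQ: "P < n + 2" "Q < n" "k = P * n + Q"
    unfolding P_Q_def using div_mod_index[OF k] by simp_all
  have "instance_row n (input_matrix n x) (input_matrix n x n) (input_matrix n x (n + 1)) P =
      input_matrix n x P"
    using PQ(1) by (auto simp: instance_row_def less_Suc_eq)
  then have "?y ! i = symbol_bits (symbol_at x k) ! e"
    unfolding i(1) PQ(3) using nth_encode_instance[OF PQ(1,2) i(2)] PQ(1,2)
    by (simp add: input_matrix_def)
  also have "\<dots> = x ! i"
  proof -
    have "x ! (2 * k) \<longrightarrow> x ! (2 * k + 1)" using valid k by (simp add: valid_input_def)
    moreover have "e = 0 \<or> e = 1" using i(2) by auto
    ultimately show ?thesis unfolding i(1) by (auto simp: symbol_at_def symbol_bits_def)
  qed
  finally show "?y ! i = x ! i" .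
qed

lemma abs_input_matrix_le: "\<bar>input_matrix n x P R\<bar> \<le> 1"
  by (simp add: input_matrix_def symbol_at_def)

section \<open>Walks\<close>

lemma no_walk_iff:
  assumes "P < n"
  shows "no_walk n d h P \<longleftrightarrow> (\<nexists>Q. (P, Q) \<in> dag_edges {..<n} d ^^ h)"
  using assms
proof (induction h arbitrary: P)
  case (Suc h)
  have "(\<exists>Q. (P, Q) \<in> dag_edges {..<n} d ^^ Suc h) \<longleftrightarrow>
      (\<exists>R Q. (P, R) \<in> dag_edges {..<n} d \<and> (R, Q) \<in> dag_edges {..<n} d ^^ h)"
    by (metis relpow_Suc_D2 relpow_Suc_I2)
  also have "\<dots> \<longleftrightarrow> (\<exists>R<n. d P R \<noteq> 0 \<and> \<not> no_walk n d h R)"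
    using Suc by (auto simp: dag_edges_def)
  finally show ?case by auto
qed auto

lemma relpow_mult_cycle:
  fixes R :: "('a \<times> 'a) set"
  shows "(x, x) \<in> R ^^ k \<Longrightarrow> (x, x) \<in> R ^^ (m * k)"
  by (induction m) (auto simp: relpow_add)

lemma relpow_prefix:
  fixes R :: "('a \<times> 'a) set"
  shows "(x, z) \<in> R ^^ (i + j) \<Longrightarrow> \<exists>y. (x, y) \<in> R ^^ i"
  by (auto simp: relpow_add)

text \<open>Pigeonhole on the start nodes of the edges. It makes the set in \<open>pc_depth\<close>
  finite, without which its \<open>Max\<close> would say nothing.\<close>

lemma acyclic_walk_length:
  assumes "acyclic (dag_edges {..<n} d)" "(P, Q) \<in> dag_edges {..<n} d ^^ k"
  shows "k \<le> n"
proof (rule ccontr)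
  let ?R = "dag_edges {..<n} d"
  assume "\<not> k \<le> n"
  obtain f where f: "\<forall>i<k. (f i, f (Suc i)) \<in> ?R"
    using assms(2) unfolding relpow_fun_conv by blast
  have "f ` {..<k} \<subseteq> {..<n}" using f by (auto simp: dag_edges_def)
  then have "card (f ` {..<k}) \<le> n" using card_mono[of "{..<n}"] by fastforce
  then have "\<not> inj_on f {..<k}" using \<open>\<not> k \<le> n\<close> card_image[of f "{..<k}"] by auto
  then obtain i j where ij: "i < j" "j < k" "f i = f j"
    unfolding inj_on_def by (metis lessThan_iff linorder_neqE_nat)
  have "(f i, f (i + m)) \<in> ?R\<^sup>*" if "i + m \<le> k" for m
    using that f by (induction m) (auto intro: rtrancl.rtrancl_into_rtrancl)
  from this[of "j - i - 1"] have "(f i, f (j - 1)) \<in> ?R\<^sup>*" using ij by simp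
  moreover have "(f (j - 1), f j) \<in> ?R" using f[rule_format, of "j - 1"] ij by simp
  ultimately have "(f i, f i) \<in> ?R\<^sup>+" using ij(3) by (metis rtrancl_into_trancl1)
  then show False using assms(1) by (auto simp: acyclic_def)
qed

text \<open>One test settles both properties: a cycle can be repeated beyond length
  \<open>D\<close>, and every walk longer than \<open>D\<close> has a prefix with exactly
  \<open>Suc D\<close> edges.\<close>

lemma no_walk_depth_iff:
  "(\<forall>P<n. no_walk n d (Suc D) P) \<longleftrightarrow>
    acyclic (dag_edges {..<n} d) \<and> pc_depth {..<n} d \<le> D"
proof -
  let ?R = "dag_edges {..<n} d"
  let ?K = "{k. \<exists>P Q. (P, Q) \<in> ?R ^^ k}"
  have "0 \<in> ?K" by auto
  show ?thesis
  proof
    assume "\<forall>P<n. no_walk n d (Suc D) P"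
    moreover have "P < n" if "(P, Q) \<in> ?R ^^ Suc D" for P Q
      using relpow_Suc_D2[OF that] by (auto simp: dag_edges_def)
    ultimately have none: "(P, Q) \<notin> ?R ^^ Suc D" for P Q
      using no_walk_iff by blast
    have short: "k \<le> D" if "(P, Q) \<in> ?R ^^ k" for k P Q
    proof (rule ccontr)
      assume "\<not> k \<le> D"
      then have "k = Suc D + (k - Suc D)" by simp
      then show False using relpow_prefix none that by metis
    qed
    have "acyclic ?R"
      unfolding acyclic_def
    proof (intro allI notI)
      fix x assume "(x, x) \<in> ?R\<^sup>+"
      then obtain k where "k > 0" "(x, x) \<in> ?R ^^ k" by (auto simp: trancl_power)
      then have "Suc D * k \<le> D" using short[OF relpow_mult_cycle] by blast
      then show False using \<open>k > 0\<close> by (cases k) auto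
    qed
    moreover have sub: "?K \<subseteq> {..D}" using short by blast
    have "Max ?K \<le> D"
    proof (rule Max.boundedI)
      show "finite ?K" using sub by (rule finite_subset) simp
      show "?K \<noteq> {}" using \<open>0 \<in> ?K\<close> by blast
    qed (use sub in blast)
    then have "pc_depth {..<n} d \<le> D" by (simp add: pc_depth_def)
    ultimately show "acyclic ?R \<and> pc_depth {..<n} d \<le> D" by blast
  next
    assume *: "acyclic ?R \<and> pc_depth {..<n} d \<le> D"
    then have "?K \<subseteq> {..n}" using acyclic_walk_length by blast
    then have "finite ?K" by (rule finite_subset) simp
    then have "k \<le> D" if "k \<in> ?K" for k
      using * Max_ge[OF _ that] unfolding pc_depth_def by linarith
    then show "\<forall>P<n. no_walk n d (Suc D) P"
      using no_walk_iff not_less_eq_eq by blast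
  qed
qed

section \<open>Correctness of the decision\<close>

lemma marking_eval_cong:
  "(\<And>P. P \<in> \<Gamma> \<Longrightarrow> M P = M' P) \<Longrightarrow> marking_eval \<Gamma> \<delta> M = marking_eval \<Gamma> \<delta> M'"
  unfolding marking_eval_def by (intro sum.cong) auto

lemma dag_edges_cong:
  "(\<And>P Q. P \<in> \<Gamma> \<Longrightarrow> Q \<in> \<Gamma> \<Longrightarrow> \<delta> P Q = \<delta>' P Q) \<Longrightarrow> dag_edges \<Gamma> \<delta> = dag_edges \<Gamma> \<delta>'"
  unfolding dag_edges_def by auto

text \<open>\<open>\<phi>\<close> is the comparison expressed through the outcomes of \<open>L < M\<close> and \<open>M < L\<close>.\<close>

definition decision ::
    "nat \<Rightarrow> nat \<Rightarrow> nat \<Rightarrow> (bool \<Rightarrow> bool \<Rightarrow> bool) \<Rightarrow> bool list \<Rightarrow> bool" where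
  "decision n \<beta> h \<phi> x \<longleftrightarrow>
     (let less = diff_less n (2 ^ \<beta>) (input_matrix n x) (fst (states n \<beta> (input_matrix n x) h))
                   (snd (states n \<beta> (input_matrix n x) h))
      in valid_input n x \<and> (\<forall>P\<in>{..<n}. no_walk n (input_matrix n x) h P) \<and>
         (\<forall>P\<in>{..<n}. \<not> less P (n + 2) 0) \<and> \<phi> (less n (n + 1) 0) (less (n + 1) n 0))"

text \<open>About the instance only the symbols are assumed to be legal. Acyclicity, depth and
  validity of the node values are for the decision to find out.\<close>

locale encoded_instance =
  fixes n \<beta> :: nat and \<delta> :: "nat \<Rightarrow> nat \<Rightarrow> int" and L M :: "nat \<Rightarrow> int" and x :: "bool list"
  assumes x: "x = encode_instance n \<delta> L M"
    and markings: "\<forall>P\<in>{..<n}. marking {..<n} (\<delta> P)" "marking {..<n} L" "marking {..<n} M"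
    and block_size: "2 * int n + 2 * 2 ^ \<beta> + 3 \<le> 2 ^ (2 ^ \<beta>)"
begin

abbreviation d :: "nat \<Rightarrow> nat \<Rightarrow> int" where "d \<equiv> input_matrix n x"

sublocale succ_matrix n \<beta> d
proof unfold_locales
  show "\<bar>d P R\<bar> \<le> 1" for P R by (rule abs_input_matrix_le)
  show "2 * int n + 2 * 2 ^ \<beta> + 3 \<le> 2 ^ (2 ^ \<beta>)" by (rule block_size)
qed (simp_all add: input_matrix_def)

lemma d_eq: "P < n + 2 \<Longrightarrow> Q < n \<Longrightarrow> d P Q = instance_row n \<delta> L M P Q"
  unfolding x using markings
  by (intro input_matrix_encode) (auto simp: instance_row_def marking_def Pi_iff less_Suc_eq)

lemma edges_eq: "dag_edges {..<n} d = dag_edges {..<n} \<delta>"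
  by (rule dag_edges_cong) (simp add: d_eq instance_row_def)

definition val :: "nat \<Rightarrow> real" where
  "val P = marking_eval {..<n} \<delta> (d P)"

text \<open>A successor with a value such as 1/2 can make \<open>val P\<close> fractional; the floor
  merely totalizes and agrees with \<open>val P\<close> on good nodes.\<close>

definition exponent :: "nat \<Rightarrow> int" where
  "exponent P = \<lfloor>val P\<rfloor>"

definition good :: "nat \<Rightarrow> bool" where
  "good P \<longleftrightarrow> (\<exists>k::nat. node_eval {..<n} \<delta> P = 2 ^ k)"

lemma val_node: "P < n \<Longrightarrow> val P = marking_eval {..<n} \<delta> (\<delta> P)"
  unfolding val_def by (rule marking_eval_cong) (simp add: d_eq instance_row_def)

lemma val_L: "val n = marking_eval {..<n} \<delta> L"
  unfolding val_def by (rule marking_eval_cong) (simp add: d_eq instance_row_def)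

lemma val_M: "val (n + 1) = marking_eval {..<n} \<delta> M"
  unfolding val_def by (rule marking_eval_cong) (simp add: d_eq[of "n + 1", simplified] instance_row_def)

lemma exponent_zero: "exponent (n + 2) = 0"
  by (simp add: exponent_def val_def marking_eval_def input_matrix_def)

context
  assumes acyclic: "acyclic (dag_edges {..<n} \<delta>)"
begin

lemma node_eval_val: "P < n \<Longrightarrow> node_eval {..<n} \<delta> P = 2 powr val P"
  using node_eval_eq[OF _ acyclic] by (simp add: val_node)

lemma good_iff:
  assumes "P < n"
  shows "good P \<longleftrightarrow> (\<exists>k::nat. val P = real k)"
proof -
  have "(2 powr val P = 2 ^ k) \<longleftrightarrow> val P = real k" for k :: nat
  proof -
    have "(2::real) ^ k = 2 powr real k" by (simp add: powr_realpow)
    then show ?thesis using powr_inj[of 2 "val P" "real k"] by simp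
  qed
  then show ?thesis by (simp only: good_def node_eval_val[OF assms])
qed

lemma good_exponent:
  assumes "P < n" "good P"
  shows "0 \<le> exponent P" "node_eval {..<n} \<delta> P = 2 ^ nat (exponent P)"
proof -
  obtain k :: nat where k: "val P = real k" using assms good_iff by blast
  then have exponent: "exponent P = int k" by (simp add: exponent_def)
  then show "0 \<le> exponent P" by simp
  have "(2::real) powr real k = 2 ^ k" by (simp add: powr_realpow)
  then show "node_eval {..<n} \<delta> P = 2 ^ nat (exponent P)"
    by (simp only: node_eval_val[OF assms(1)] k exponent nat_int)
qed

lemma val_eq:
  assumes "\<And>R. R < n \<Longrightarrow> d P R \<noteq> 0 \<Longrightarrow> good R"
  shows "val P = real_of_int (exponent_sum n d exponent P)"
proof -
  have summand: "real_of_int (d P R) * node_eval {..<n} \<delta> R = real_of_int (d P R * 2 ^ nat (exponent R))"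
    if "R < n" for R
    using good_exponent(2)[OF that] assms[OF that] by (cases "d P R = 0") auto
  then show ?thesis
    unfolding val_def marking_eval_def exponent_sum_def of_int_sum by (intro sum.cong refl summand) (simp only: lessThan_iff)
qed

text \<open>Above good successors the exponent is an integer, so only its sign can prevent the node
  value from being a natural power of two.\<close>

lemma good_iff_exponent_sum:
  assumes "P < n" "\<And>R. R < n \<Longrightarrow> d P R \<noteq> 0 \<Longrightarrow> good R"
  shows "good P \<longleftrightarrow> 0 \<le> exponent_sum n d exponent P"
proof -
  let ?S = "exponent_sum n d exponent P"
  have "val P = real_of_int ?S" by (rule val_eq[OF assms(2)])
  moreover have "(\<exists>k::nat. real_of_int ?S = real k) \<longleftrightarrow> 0 \<le> ?S"
  proof
    assume "\<exists>k::nat. real_of_int ?S = real k"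
    then have "0 \<le> real_of_int ?S" by auto
    then show "0 \<le> ?S" by simp
  next
    assume "0 \<le> ?S"
    then show "\<exists>k::nat. real_of_int ?S = real k" by (intro exI[of _ "nat ?S"]) simp
  qed
  ultimately show ?thesis using good_iff[OF assms(1)] by simp
qed

lemma diff_less_good:
  assumes A: "A \<subseteq> {..<n}" "\<And>R. R \<in> A \<Longrightarrow> good R" "\<And>R S. R \<in> A \<Longrightarrow> d R S \<noteq> 0 \<Longrightarrow> S \<in> A"
    and "\<And>R. R < n \<Longrightarrow> no_walk n d h R"
    and "\<And>R. d P R \<noteq> 0 \<Longrightarrow> R \<in> A" "\<And>R. d Q R \<noteq> 0 \<Longrightarrow> R \<in> A"
  shows "diff_less n b d (fst (states n \<beta> d h)) (snd (states n \<beta> d h)) P Q 0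
    \<longleftrightarrow> exponent_sum n d exponent P < exponent_sum n d exponent Q"
proof (rule diff_less_states)
  fix R assume R: "R \<in> A"
  show "0 \<le> exponent R" using good_exponent(1) A R by blast
  have "val R = real_of_int (exponent_sum n d exponent R)"
    by (rule val_eq) (use A R in blast)
  then show "exponent R = exponent_sum n d exponent R" by (simp add: exponent_def)
  show "no_walk n d h R" using assms(4) A(1) R by blast
  show "S \<in> A" if "d R S \<noteq> 0" for S using A(3)[OF R that] .
qed (rule exponent_zero assms; assumption)+

lemma exponent_sum_zero: "exponent_sum n d exponent (n + 2) = 0"
  by (simp add: exponent_sum_def input_matrix_def)

text \<open>The test at \<open>P\<close> is meaningful only if the nodes it sums over are good,
  which is what is being tested. Well-founded induction from the sinks upwards resolves this: when
  \<open>P\<close> is reached, everything below it is known to be good.\<close>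

lemma all_good_iff:
  assumes walk: "\<And>R. R < n \<Longrightarrow> no_walk n d h R"
  shows "(\<forall>P<n. \<not> diff_less n b d (fst (states n \<beta> d h)) (snd (states n \<beta> d h)) P (n + 2) 0)
    \<longleftrightarrow> (\<forall>P<n. good P)"
proof
  assume good: "\<forall>P<n. good P"
  show "\<forall>P<n. \<not> diff_less n b d (fst (states n \<beta> d h)) (snd (states n \<beta> d h)) P (n + 2) 0"
  proof (intro allI impI)
    fix P assume "P < n"
    have col: "R \<in> {..<n}" if "d S R \<noteq> 0" for R S
      using that columns[of R S] by (meson lessThan_iff not_le)
    have "diff_less n b d (fst (states n \<beta> d h)) (snd (states n \<beta> d h)) P (n + 2) 0
        \<longleftrightarrow> exponent_sum n d exponent P < exponent_sum n d exponent (n + 2)"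
      by (rule diff_less_good[of "{..<n}"]) (use good walk col in blast)+
    moreover have "0 \<le> exponent_sum n d exponent P"
      using good_iff_exponent_sum[OF \<open>P < n\<close>] good \<open>P < n\<close> by blast
    ultimately show "\<not> diff_less n b d (fst (states n \<beta> d h)) (snd (states n \<beta> d h)) P (n + 2) 0"
      unfolding exponent_sum_zero by linarith
  qed
next
  assume *: "\<forall>P<n. \<not> diff_less n b d (fst (states n \<beta> d h)) (snd (states n \<beta> d h)) P (n + 2) 0"
  let ?R = "dag_edges {..<n} \<delta>"
  have "finite ?R"
    by (rule finite_subset[of _ "{..<n} \<times> {..<n}"]) (auto simp: dag_edges_def)
  then have "wf ((?R\<inverse>)\<^sup>+)" using acyclic by (intro wf_trancl finite_acyclic_wf_converse)
  then show "\<forall>P<n. good P"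
  proof (intro allI impI)
    fix P assume "wf ((?R\<inverse>)\<^sup>+)" "P < n"
    then show "good P"
    proof (induction P rule: wf_induct_rule)
      case (less P)
      \<comment> \<open>The proper descendants of \<open>P\<close>: closed under successors, good by
        induction, and containing the successors of \<open>P\<close>, as the comparison with the
        zero row needs.\<close>
      define A where "A = {R. (P, R) \<in> ?R\<^sup>+}"
      have edge: "(R, S) \<in> ?R" if "R < n" "d R S \<noteq> 0" for R S
        using that columns[of S R] edges_eq by (cases "S < n") (auto simp: dag_edges_def)
      have A: "A \<subseteq> {..<n}" using trancl_subset_Sigma[of ?R "{..<n}"]
        by (auto simp: A_def dag_edges_def)
      have good_A: "good R" if "R \<in> A" for R
        using less.IH[of R] that A by (auto simp: A_def trancl_converse)
      have "diff_less n b d (fst (states n \<beta> d h)) (snd (states n \<beta> d h)) P (n + 2) 0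
          \<longleftrightarrow> exponent_sum n d exponent P < exponent_sum n d exponent (n + 2)"
      proof (rule diff_less_good[OF A good_A])
        show "S \<in> A" if "R \<in> A" "d R S \<noteq> 0" for R S
          using that edge[of R S] A by (auto simp: A_def intro: trancl_into_trancl)
        show "R \<in> A" if "d P R \<noteq> 0" for R
          using edge[OF less.prems that] by (auto simp: A_def)
        show "R \<in> A" if "d (n + 2) R \<noteq> 0" for R
          using that last_row by simp
      qed (use walk in auto)
      moreover have "good P \<longleftrightarrow> 0 \<le> exponent_sum n d exponent P"
        by (rule good_iff_exponent_sum[OF less.prems])
          (use edge[OF less.prems] good_A in \<open>auto simp: A_def\<close>)
      ultimately show "good P"
        using *[rule_format, OF less.prems] unfolding exponent_sum_zero by linarith
    qed
  qed
qed

end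

text \<open>If the graph is cyclic or too deep, the walk test alone rejects; otherwise
  \<open>Suc D\<close> rounds have reached every node, since heights are at most
  \<open>D\<close>.\<close>

lemma decision_iff:
  "decision n \<beta> (Suc D) \<phi> x \<longleftrightarrow> power_circuit {..<n} \<delta> \<and> pc_depth {..<n} \<delta> \<le> D \<and>
     \<phi> (marking_eval {..<n} \<delta> L < marking_eval {..<n} \<delta> M)
       (marking_eval {..<n} \<delta> M < marking_eval {..<n} \<delta> L)"
proof (cases "acyclic (dag_edges {..<n} \<delta>) \<and> pc_depth {..<n} \<delta> \<le> D")
  case False
  then have "\<not> (\<forall>P<n. no_walk n d (Suc D) P)"
    using no_walk_depth_iff[of n d D] by (simp add: edges_eq pc_depth_def)
  then show ?thesis using False by (auto simp: decision_def power_circuit_def Let_def)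
next
  case True
  then have walk: "\<forall>P<n. no_walk n d (Suc D) P"
    using no_walk_depth_iff[of n d D] by (simp add: edges_eq pc_depth_def)
  define less where "less = diff_less n b d (fst (states n \<beta> d (Suc D))) (snd (states n \<beta> d (Suc D)))"
  have acyclic: "acyclic (dag_edges {..<n} \<delta>)" using True by blast
  have good: "(\<forall>P<n. \<not> less P (n + 2) 0) \<longleftrightarrow> (\<forall>P<n. good P)"
    unfolding less_def using walk by (intro all_good_iff acyclic) blast
  have circuit: "power_circuit {..<n} \<delta> \<longleftrightarrow> (\<forall>P<n. good P)"
    using acyclic markings(1) by (auto simp: power_circuit_def good_def)
  have cmp: "less P Q 0 \<longleftrightarrow> val P < val Q" if "\<forall>P<n. good P" for P Q
  proof -
    have "less P Q 0 \<longleftrightarrow> exponent_sum n d exponent P < exponent_sum n d exponent Q"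
      unfolding less_def
    proof (rule diff_less_good[OF acyclic, of "{..<n}"])
      show col: "R \<in> {..<n}" if "d S R \<noteq> 0" for R S
        using that columns[of R S] by (meson lessThan_iff not_le)
      show "R \<in> {..<n}" if "d P R \<noteq> 0" for R using that by (rule col)
      show "R \<in> {..<n}" if "d Q R \<noteq> 0" for R using that by (rule col)
      show "good R" if "R \<in> {..<n}" for R using that \<open>\<forall>P<n. good P\<close> by blast
      show "no_walk n d (Suc D) R" if "R < n" for R using that walk by blast
    qed blast
    then show ?thesis using that by (simp add: val_eq[OF acyclic])
  qed
  have "decision n \<beta> (Suc D) \<phi> x \<longleftrightarrow>
      (\<forall>P<n. \<not> less P (n + 2) 0) \<and> \<phi> (less n (n + 1) 0) (less (n + 1) n 0)"
    using walk valid_encode_instance[of n \<delta> L M, folded x] unfolding decision_def less_def Let_def by blast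
  also have "\<dots> \<longleftrightarrow> (\<forall>P<n. good P) \<and> \<phi> (val n < val (n + 1)) (val (n + 1) < val n)"
    unfolding good using cmp by auto
  finally show ?thesis using True circuit by (simp add: val_L val_M[simplified])
qed

end

section \<open>Circuits for the decision\<close>

text \<open>At \<open>h = 0\<close> the walk tests and the state do not depend on the input, so they
  are supplied as constants and no wires are needed.\<close>

definition layer_funs :: "nat \<Rightarrow> nat \<Rightarrow> nat \<Rightarrow> (bool list \<Rightarrow> bool) set" where
  "layer_funs n \<beta> h = (if h = 0 then {} else
     (\<lambda>P x. no_walk n (input_matrix n x) h P) ` {..<n} \<union>
     (\<lambda>(R, i) x. fst (states n \<beta> (input_matrix n x) h) R i) ` ({..<n + 3} \<times> {..<2 ^ \<beta>}) \<union>
     (\<lambda>(R, R', t) x. snd (states n \<beta> (input_matrix n x) h) R R' t) `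
       ({..<n + 3} \<times> {..<n + 3} \<times> {..2}))"

lemma finite_layer_funs: "finite (layer_funs n \<beta> h)"
  by (simp add: layer_funs_def)

lemma card_layer_funs:
  "card (layer_funs n \<beta> h) \<le> n + (n + 3) * 2 ^ \<beta> + (n + 3) * ((n + 3) * 3)"
proof -
  let ?A = "(\<lambda>P x. no_walk n (input_matrix n x) h P) ` {..<n}"
  let ?B = "(\<lambda>(R, i) x. fst (states n \<beta> (input_matrix n x) h) R i) ` ({..<n + 3} \<times> {..<2 ^ \<beta>})"
  let ?C = "(\<lambda>(R, R', t) x. snd (states n \<beta> (input_matrix n x) h) R R' t) `
       ({..<n + 3} \<times> {..<n + 3} \<times> {..2})"
  have "card ?A \<le> n" using card_image_le[of "{..<n}"] by fastforce
  moreover have "card ?B \<le> card ({..<n + 3} \<times> {..<2 ^ \<beta> :: nat})"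
    by (rule card_image_le) simp
  moreover have "card ?C \<le> card ({..<n + 3} \<times> {..<n + 3} \<times> {..2 :: nat})"
    by (rule card_image_le) simp
  moreover have "card (?A \<union> ?B \<union> ?C) \<le> card ?A + card ?B + card ?C"
    using card_Un_le[of "?A \<union> ?B" ?C] card_Un_le[of ?A ?B] by linarith
  ultimately have "card (?A \<union> ?B \<union> ?C) \<le> n + (n + 3) * 2 ^ \<beta> + (n + 3) * ((n + 3) * 3)"
    by (simp only: card_cartesian_product card_lessThan card_atMost numeral_3_eq_3 numeral_2_eq_2)
  then show ?thesis by (cases "h = 0") (simp_all add: layer_funs_def)
qed

locale layered_instance =
  fixes n \<beta> m h :: nat and F :: "(bool list \<Rightarrow> bool) set"
  assumes width: "n + 3 \<le> m" "2 ^ \<beta> \<le> m" "(2 * sum_bound n (2 ^ \<beta>) + 1)\<^sup>2 \<le> m"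
    "(n + 2) * n \<le> m"
  defines "F \<equiv> layer_funs n \<beta> h \<union> input_bits ((n + 2) * (n * 2))"
begin

lemma tform_input: "i < (n + 2) * (n * 2) \<Longrightarrow> tform F m k (\<lambda>x. x ! i)"
  by (rule tform_base) (auto simp: F_def input_bits_def)

lemma two_le_m: "2 \<le> m"
  using width(1) by linarith

lemma cell_index:
  assumes "P < n + 2" "R < n"
  shows "2 * (P * n + R) + 1 < (n + 2) * (n * 2)"
proof -
  have "(P + 1) * n \<le> (n + 2) * n" using assms(1) by (intro mult_right_mono) auto
  then have "P * n + R < (n + 2) * n" using assms(2) by simp
  then show ?thesis by simp
qed

lemma unary_sum_entry: "unary_sum F m 2 2 (\<lambda>x. input_matrix n x P R)"
proof (cases "P < n + 2 \<and> R < n")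
  case True
  define k where "k = P * n + R"
  have k: "2 * k + 1 < (n + 2) * (n * 2)" using cell_index True by (simp add: k_def)
  have "unary_sum F m (Suc (Suc 0)) (1 + 1) (\<lambda>x. symbol_at x k)"
    unfolding symbol_at_def
    using k
    by (intro unary_sum_diff unary_sum_of_bool tform_conj[OF two_le_m] tform_Not tform_input) simp_all
  then show ?thesis using True by (simp add: input_matrix_def k_def numeral_2_eq_2)
next
  case False
  then have "(\<lambda>x. input_matrix n x P R) = (\<lambda>x. 0)" by (auto simp: input_matrix_def)
  then show ?thesis by (simp only: unary_sum_zero)
qed

lemma tform_edge: "tform F m 2 (\<lambda>x. input_matrix n x P R \<noteq> 0)"
proof (cases "P < n + 2 \<and> R < n")
  case True
  then have "(\<lambda>x. input_matrix n x P R \<noteq> 0) = (\<lambda>x. x ! (2 * (P * n + R) + 1))"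
    by (auto simp: input_matrix_def symbol_at_def)
  then show ?thesis using True cell_index by (simp only: tform_input)
next
  case False
  then have "(\<lambda>x. input_matrix n x P R \<noteq> 0) = (\<lambda>x. False)" by (auto simp: input_matrix_def)
  then show ?thesis using tform_const[of F m 1 False] by (simp add: numeral_2_eq_2)
qed

sublocale state_formulas F m n \<beta> "input_matrix n"
  "\<lambda>x. fst (states n \<beta> (input_matrix n x) h)" "\<lambda>x. snd (states n \<beta> (input_matrix n x) h)"
proof
  have const: "tform F m 2 (\<lambda>x. c)" for c
    using tform_const[of F m 1 c] by (simp add: numeral_2_eq_2)
  show "tform F m 2 (\<lambda>x. fst (states n \<beta> (input_matrix n x) h) R i)"
    if "R < n + 3" "i < 2 ^ \<beta>" for R i
  proof (cases "h = 0")
    case False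
    then show ?thesis using that by (intro tform_base) (force simp: F_def layer_funs_def)
  qed (simp add: const)
  show "tform F m 2 (\<lambda>x. snd (states n \<beta> (input_matrix n x) h) R R' t)"
    if "R < n + 3" "R' < n + 3" "t \<le> 2" for R R' t
  proof (cases "h = 0")
    case False
    then show ?thesis using that by (intro tform_base) (force simp: F_def layer_funs_def)
  qed (simp add: const)
qed (rule unary_sum_entry tform_edge width)+

lemma tform_no_walk:
  assumes "P < n"
  shows "tform F m 2 (\<lambda>x. no_walk n (input_matrix n x) h P)"
proof (cases "h = 0")
  case True
  then show ?thesis using tform_const[of F m 1 False] by (simp add: numeral_2_eq_2)
next
  case False
  then show ?thesis using assms by (intro tform_base) (auto simp: F_def layer_funs_def)
qed

lemma tform_next_layer:
  assumes "f \<in> layer_funs n \<beta> (Suc h)"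
  shows "tform F m 26 f"
proof -
  let ?d = "input_matrix n"
  consider (walk) P where "P < n" "f = (\<lambda>x. no_walk n (?d x) (Suc h) P)"
    | (res) R i where "f = (\<lambda>x. fst (states n \<beta> (?d x) (Suc h)) R i)"
    | (gap) R R' t where "t \<le> 2" "f = (\<lambda>x. snd (states n \<beta> (?d x) (Suc h)) R R' t)"
    using assms unfolding layer_funs_def by auto
  then show ?thesis
  proof cases
    case walk
    have "tform F m (Suc (2 + 2)) f"
      unfolding walk(2) no_walk.simps using width(1)
      by (intro tform_ball tform_imp two_le_m tform_edge tform_no_walk) simp_all
    then show ?thesis by (rule tform_mono) simp
  next
    case res
    then show ?thesis using tform_mono[OF tform_next_residue] by simp
  next
    case gap
    then show ?thesis using tform_mono[OF tform_next_gap] by simp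
  qed
qed

lemma tform_valid_input: "tform F m 3 (valid_input n)"
proof -
  have "tform F m (Suc (0 + 2)) (\<lambda>x. valid_input n x)"
    unfolding valid_input_def using width(4)
    by (intro tform_ball tform_imp two_le_m tform_input) simp_all
  then show ?thesis by (simp add: numeral_3_eq_3)
qed

text \<open>Tabulates an arbitrary Boolean function of two formulas, which lets one construction
  serve all six relations.\<close>

lemma tform_bool_fun:
  assumes "tform F m k f" "tform F m k g"
  shows "tform F m (k + 4) (\<lambda>x. \<phi> (f x) (g x))"
proof -
  have card: "card U \<le> m" for U :: "bool set"
    using card_mono[of UNIV U] two_le_m by simp
  have eq: "tform F m (Suc k) (\<lambda>x. f x = c)" if "tform F m k f" for f c
    using tform_Not[OF that] tform_mono[OF that, of "Suc k"] by (cases c) simp_all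
  have "tform F m (Suc (Suc (Suc (Suc k)))) (\<lambda>x. \<exists>u\<in>UNIV. f x = u \<and> (\<exists>v\<in>{v. \<phi> u v}. g x = v))"
    by (intro tform_bex tform_conj two_le_m eq assms card finite tform_mono[OF eq[OF assms(1)]]) simp
  moreover have "\<phi> (f x) (g x) \<longleftrightarrow> (\<exists>u\<in>UNIV. f x = u \<and> (\<exists>v\<in>{v. \<phi> u v}. g x = v))" for x
    by blast
  moreover have "Suc (Suc (Suc (Suc k))) = k + 4" by simp
  ultimately show ?thesis by (simp only:)
qed

lemma tform_decision: "tform F m 28 (decision n \<beta> h \<phi>)"
proof -
  have less: "tform F m 21 (\<lambda>x. diff_less n b (input_matrix n x) (fst (states n \<beta> (input_matrix n x) h))
      (snd (states n \<beta> (input_matrix n x) h)) P Q 0)" for P Q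
    by (rule tform_diff_less) simp
  have "n \<le> m" using width(1) by simp
  have valid: "tform F m 27 (\<lambda>x. valid_input n x)"
    by (rule tform_mono[OF tform_valid_input]) simp
  have "tform F m (Suc 2) (\<lambda>x. \<forall>P\<in>{..<n}. no_walk n (input_matrix n x) h P)"
    using \<open>n \<le> m\<close> by (intro tform_ball tform_no_walk) simp_all
  then have walk: "tform F m 26 (\<lambda>x. \<forall>P\<in>{..<n}. no_walk n (input_matrix n x) h P)"
    by (rule tform_mono) simp
  have "tform F m (Suc (Suc 21)) (\<lambda>x. \<forall>P\<in>{..<n}. \<not> diff_less n b (input_matrix n x)
      (fst (states n \<beta> (input_matrix n x) h)) (snd (states n \<beta> (input_matrix n x) h)) P (n + 2) 0)"
    using \<open>n \<le> m\<close> by (intro tform_ball tform_Not less) simp_all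
  then have nonneg: "tform F m 25 (\<lambda>x. \<forall>P\<in>{..<n}. \<not> diff_less n b (input_matrix n x)
      (fst (states n \<beta> (input_matrix n x) h)) (snd (states n \<beta> (input_matrix n x) h)) P (n + 2) 0)"
    by (rule tform_mono) simp
  have cmp: "tform F m 25 (\<lambda>x. \<phi>
      (diff_less n b (input_matrix n x) (fst (states n \<beta> (input_matrix n x) h))
        (snd (states n \<beta> (input_matrix n x) h)) n (n + 1) 0)
      (diff_less n b (input_matrix n x) (fst (states n \<beta> (input_matrix n x) h))
        (snd (states n \<beta> (input_matrix n x) h)) (n + 1) n 0))"
    using tform_bool_fun[OF less less, of \<phi> n "n + 1" "n + 1" n] by simp
  have inner: "tform F m 26 (\<lambda>x. (\<forall>P\<in>{..<n}. \<not> diff_less n b (input_matrix n x)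
      (fst (states n \<beta> (input_matrix n x) h)) (snd (states n \<beta> (input_matrix n x) h)) P (n + 2) 0) \<and>
      \<phi> (diff_less n b (input_matrix n x) (fst (states n \<beta> (input_matrix n x) h))
        (snd (states n \<beta> (input_matrix n x) h)) n (n + 1) 0)
      (diff_less n b (input_matrix n x) (fst (states n \<beta> (input_matrix n x) h))
        (snd (states n \<beta> (input_matrix n x) h)) (n + 1) n 0))"
    using tform_conj[OF two_le_m nonneg cmp] by simp
  show ?thesis
    using tform_conj[OF two_le_m valid, OF tform_conj[OF two_le_m walk inner, simplified]]
    unfolding decision_def[abs_def] Let_def by simp
qed

end

lemma layered_decision:
  assumes "n + 3 \<le> m" "2 ^ \<beta> \<le> m" "(2 * sum_bound n (2 ^ \<beta>) + 1)\<^sup>2 \<le> m" "(n + 2) * n \<le> m"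
    and q: "n + (n + 3) * 2 ^ \<beta> + (n + 3) * ((n + 3) * 3) \<le> q"
  defines "N \<equiv> (n + 2) * (n * 2)"
  shows "\<exists>c. circuit_wf N c \<and> (\<forall>x. length x = N \<longrightarrow> accepts c x = decision n \<beta> h \<phi> x) \<and>
    circuit_size c \<le> N + h * (q * (m + 3) ^ 28) + (m + 3) ^ 28 + 2 \<and>
    circuit_depth c \<le> h * 28 + 28 + 1"
proof (rule layered_circuit[where F = "layer_funs n \<beta>"])
  have layered: "layered_instance n \<beta> m" using assms(1-4) by unfold_locales
  show "tform (layer_funs n \<beta> h \<union> input_bits N) m 28 f" if "f \<in> layer_funs n \<beta> (Suc h)" for h f
    unfolding N_def
    by (rule tform_mono[OF layered_instance.tform_next_layer[OF layered that]]) simp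
  show "tform (layer_funs n \<beta> h \<union> input_bits N) m 28 (decision n \<beta> h \<phi>)"
    unfolding N_def by (rule layered_instance.tform_decision[OF layered])
  show "card (layer_funs n \<beta> h) \<le> q" for h
    using card_layer_funs[of n \<beta> h] q by linarith
qed (simp_all add: finite_layer_funs, simp add: layer_funs_def)

section \<open>Block length and polynomial size bounds\<close>

lemma exists_block_exponent:
  fixes X :: nat
  assumes "X \<ge> 20"
  shows "\<exists>\<beta>. X \<le> 2 ^ 2 ^ \<beta> \<and> 2 ^ 2 ^ \<beta> \<le> X\<^sup>2"
proof -
  have "X < 2 ^ 2 ^ X" using less_exp[of X] less_exp[of "2 ^ X"] by linarith
  then have ex: "X \<le> 2 ^ 2 ^ X" by simp
  define \<beta> where "\<beta> = (LEAST k. X \<le> 2 ^ 2 ^ k)"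
  have \<beta>: "X \<le> 2 ^ 2 ^ \<beta>" unfolding \<beta>_def using ex by (rule LeastI)
  have "\<beta> \<noteq> 0" using \<beta> assms by (intro notI) simp
  then obtain k where k: "\<beta> = Suc k" by (cases \<beta>) auto
  have "\<not> X \<le> 2 ^ 2 ^ k" using not_less_Least[of k "\<lambda>k. X \<le> 2 ^ 2 ^ k"] k unfolding \<beta>_def by simp
  \<comment> \<open>Doubling the block length squares \<open>2 ^ 2 ^ k\<close>, so insisting on a
    power of two as block length overshoots \<open>X\<close> by at most a square.\<close>
  then have "(2 ^ 2 ^ k)\<^sup>2 \<le> X\<^sup>2" by (intro power_mono) auto
  then have "2 ^ 2 ^ \<beta> \<le> X\<^sup>2" unfolding k by (simp add: power_mult[symmetric] mult.commute)
  then show ?thesis using \<beta> by blast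
qed

lemma four_times_le_power: "b \<ge> 4 \<Longrightarrow> 4 * b \<le> (2::nat) ^ b"
  by (induction b rule: dec_induct) auto

text \<open>Half of \<open>2 ^ b >= X\<close> covers \<open>2 * n + 3\<close>, while
  \<open>4 * b <= 2 ^ b\<close> leaves the other half for \<open>2 * b\<close>. Being at least 20,
  \<open>X\<close> also absorbs small constant factors into one more power of
  \<open>X\<close>.\<close>

locale block_length =
  fixes n \<beta> X :: nat
  assumes X: "X = 4 * n + 20" and lower: "X \<le> 2 ^ 2 ^ \<beta>" and upper: "2 ^ 2 ^ \<beta> \<le> X\<^sup>2"
begin

lemma four_b_le: "4 * 2 ^ \<beta> \<le> (2::nat) ^ 2 ^ \<beta>"
proof (rule four_times_le_power, rule ccontr)
  assume "\<not> 4 \<le> (2::nat) ^ \<beta>"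
  then have "(2::nat) ^ 2 ^ \<beta> \<le> 2 ^ 4" by (intro power_increasing) auto
  then show False using lower X by simp
qed

lemma block_size: "2 * int n + 2 * 2 ^ \<beta> + 3 \<le> 2 ^ (2 ^ \<beta>)"
proof -
  have "2 * n + 2 * 2 ^ \<beta> + 3 \<le> 2 ^ 2 ^ \<beta>" using four_b_le lower X by linarith
  then have "int (2 * n + 2 * 2 ^ \<beta> + 3) \<le> int (2 ^ 2 ^ \<beta>)" by (rule of_nat_mono)
  then show ?thesis by simp
qed

lemma X_ge: "20 \<le> X" "n + 3 \<le> X"
  by (simp_all add: X)

lemma X_power_mono: "i \<le> j \<Longrightarrow> X ^ i \<le> X ^ j"
  using X_ge by (intro power_increasing) auto

lemma b_le: "2 ^ \<beta> \<le> X\<^sup>2"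
  using four_b_le upper by linarith

lemma sum_bound_le: "sum_bound n (2 ^ \<beta>) \<le> X ^ 8"
proof -
  have "4 + 2 * 2 ^ \<beta> \<le> 4 + 2 * X\<^sup>2" using b_le by simp
  also have "\<dots> \<le> 3 * X\<^sup>2"
    using X_ge power_mono[of 2 X 2] by simp
  also have "\<dots> \<le> X * X\<^sup>2" using X_ge by (intro mult_right_mono) auto
  finally have "4 + 2 * 2 ^ \<beta> \<le> X * X\<^sup>2" .
  then have "sum_bound n (2 ^ \<beta>) \<le> X * (X\<^sup>2 * (X\<^sup>2 * (X * X\<^sup>2)))"
    unfolding sum_bound_def using X_ge b_le upper by (intro mult_le_mono)
  also have "\<dots> = X ^ 8" by (simp add: power_add[symmetric] flip: power_Suc)
  finally show ?thesis .
qed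

text \<open>The third bound dictates the fan-in: \<open>2 * sum_bound n (2 ^ \<beta>) + 1\<close> is
  at most \<open>X ^ 9\<close>, and the lookup over pairs squares it.\<close>

lemma width:
  "n + 3 \<le> X ^ 18" "2 ^ \<beta> \<le> X ^ 18" "(2 * sum_bound n (2 ^ \<beta>) + 1)\<^sup>2 \<le> X ^ 18"
  "(n + 2) * n \<le> X ^ 18"
proof -
  show "n + 3 \<le> X ^ 18" using X_ge(2) X_power_mono[of 1 18] by simp
  show "2 ^ \<beta> \<le> X ^ 18" using b_le X_power_mono[of 2 18] by simp
  have "(n + 2) * n \<le> X * X" using X_ge(2) by (intro mult_le_mono) auto
  then show "(n + 2) * n \<le> X ^ 18" using X_power_mono[of 2 18] by (simp add: power2_eq_square)
  have "1 \<le> X ^ 8" using X_ge by simp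
  then have "2 * sum_bound n (2 ^ \<beta>) + 1 \<le> 3 * X ^ 8" using sum_bound_le by linarith
  also have "\<dots> \<le> X * X ^ 8" using X_ge by (intro mult_right_mono) auto
  finally have "2 * sum_bound n (2 ^ \<beta>) + 1 \<le> X ^ 9" by (simp flip: power_Suc)
  then have "(2 * sum_bound n (2 ^ \<beta>) + 1)\<^sup>2 \<le> (X ^ 9)\<^sup>2" by (rule power_mono) simp
  then show "(2 * sum_bound n (2 ^ \<beta>) + 1)\<^sup>2 \<le> X ^ 18" by (simp flip: power_mult)
qed

lemma card_bound: "n + (n + 3) * 2 ^ \<beta> + (n + 3) * ((n + 3) * 3) \<le> X ^ 4"
proof -
  have "(n + 3) * 2 ^ \<beta> \<le> X * X\<^sup>2" using X_ge b_le by (intro mult_le_mono)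
  moreover have "(n + 3) * ((n + 3) * 3) \<le> X * (X * X)" using X_ge by (intro mult_le_mono) auto
  moreover have "n \<le> X ^ 3" using X_ge(2) X_power_mono[of 1 3] by simp
  moreover have "X * X\<^sup>2 = X ^ 3" "X * (X * X) = X ^ 3"
    by (simp_all add: power3_eq_cube power2_eq_square)
  ultimately have "n + (n + 3) * 2 ^ \<beta> + (n + 3) * ((n + 3) * 3) \<le> 3 * X ^ 3" by linarith
  also have "\<dots> \<le> X * X ^ 3" using X_ge by (intro mult_right_mono) auto
  finally show ?thesis by (simp flip: power_Suc)
qed

text \<open>28 is the depth allowed for a round and for the final decision;
  \<open>X ^ 18 + 3 <= X ^ 19\<close> then gives the exponent \<open>19 * 28\<close>.\<close>

lemma formula_size: "(X ^ 18 + 3) ^ 28 \<le> X ^ 532"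
proof -
  have "X ^ 18 \<ge> 1" using X_ge by simp
  then have "X ^ 18 + 3 \<le> 4 * X ^ 18" by linarith
  also have "\<dots> \<le> X * X ^ 18" using X_ge by (intro mult_right_mono) auto
  finally have "X ^ 18 + 3 \<le> X ^ 19" by (simp flip: power_Suc)
  then have "(X ^ 18 + 3) ^ 28 \<le> (X ^ 19) ^ 28" by (rule power_mono) simp
  then show ?thesis by (simp flip: power_mult)
qed

lemma decision_circuit:
  defines "N \<equiv> (n + 2) * (n * 2)"
  shows "\<exists>c. circuit_wf N c \<and> (\<forall>x. length x = N \<longrightarrow> accepts c x = decision n \<beta> h \<phi> x) \<and>
    circuit_size c \<le> N + h * X ^ 536 + X ^ 532 + 2 \<and> circuit_depth c \<le> h * 28 + 29"
proof -
  have "X ^ 4 * (X ^ 18 + 3) ^ 28 \<le> X ^ 4 * X ^ 532" by (rule mult_le_mono2[OF formula_size])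
  also have "\<dots> = X ^ 536" by (simp flip: power_add)
  finally have layers: "h * (X ^ 4 * (X ^ 18 + 3) ^ 28) \<le> h * X ^ 536" by (rule mult_le_mono2)
  obtain c where "circuit_wf N c" "\<forall>x. length x = N \<longrightarrow> accepts c x = decision n \<beta> h \<phi> x"
    "circuit_size c \<le> N + h * (X ^ 4 * (X ^ 18 + 3) ^ 28) + (X ^ 18 + 3) ^ 28 + 2"
    "circuit_depth c \<le> h * 28 + 28 + 1"
    using layered_decision[OF width card_bound, of h \<phi>] unfolding N_def by blast
  moreover from this have "circuit_size c \<le> N + h * X ^ 536 + X ^ 532 + 2" "circuit_depth c \<le> h * 28 + 29"
    using formula_size layers by linarith+
  ultimately show ?thesis by blast
qed

lemma comparison_problem_iff:
  assumes "C > 0" and rel: "\<And>u v. rel u v \<longleftrightarrow> \<phi> (u < v) (v < u)"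
    and len: "length x = (n + 2) * (n * 2)"
  shows "x \<in> comparison_problem C rel \<longleftrightarrow> decision n \<beta> (Suc (nat \<lfloor>C * log 2 (real n)\<rfloor>)) \<phi> x"
proof -
  \<comment> \<open>Needed because \<open>nat\<close> would turn a negative bound into 0; for
    \<open>n = 0\<close> this rests on the default value of the logarithm.\<close>
  have "0 \<le> C * log 2 (real n)"
    using \<open>C > 0\<close> by (cases "n = 0") (simp_all add: log_def)
  then have depth: "k \<le> nat \<lfloor>C * log 2 (real n)\<rfloor> \<longleftrightarrow> real k \<le> C * log 2 (real n)" for k
    by (simp add: le_nat_iff le_floor_iff)
  have main: "decision n \<beta> (Suc (nat \<lfloor>C * log 2 (real n)\<rfloor>)) \<phi> x \<longleftrightarrow>
      power_circuit {..<n} \<delta> \<and> real (pc_depth {..<n} \<delta>) \<le> C * log 2 (real n) \<and>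
      rel (marking_eval {..<n} \<delta> L) (marking_eval {..<n} \<delta> M)"
    if "x = encode_instance n \<delta> L M" "\<forall>P\<in>{..<n}. marking {..<n} (\<delta> P)"
      "marking {..<n} L" "marking {..<n} M" for \<delta> L M
  proof -
    interpret encoded_instance n \<beta> \<delta> L M x
      using that block_size by unfold_locales
    show ?thesis unfolding decision_iff depth rel ..
  qed
  show ?thesis
  proof
    assume "x \<in> comparison_problem C rel"
    then obtain n' \<delta> L M where x: "x = encode_instance n' \<delta> L M" "power_circuit {..<n'} \<delta>"
      "real (pc_depth {..<n'} \<delta>) \<le> C * log 2 (real n')" "marking {..<n'} L" "marking {..<n'} M"
      "rel (marking_eval {..<n'} \<delta> L) (marking_eval {..<n'} \<delta> M)"
      unfolding comparison_problem_def by blast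
    have "(n' + 2) * (n' * 2) = (n + 2) * (n * 2)"
      using len unfolding x(1) length_encode_instance .
    \<comment> \<open>Strict monotonicity: the length of the word determines the number of
      nodes.\<close>
    moreover have "(i + 2) * (i * 2) < (j + 2) * (j * 2)" if "i < j" for i j :: nat
      by (rule mult_strict_mono) (use that in auto)
    ultimately have "n' = n" by (metis less_irrefl linorder_neqE_nat)
    then show "decision n \<beta> (Suc (nat \<lfloor>C * log 2 (real n)\<rfloor>)) \<phi> x"
      using x by (subst main[of \<delta> L M]) (auto simp: power_circuit_def)
  next
    assume dec: "decision n \<beta> (Suc (nat \<lfloor>C * log 2 (real n)\<rfloor>)) \<phi> x"
    then have valid: "valid_input n x" by (simp add: decision_def Let_def)
    let ?d = "input_matrix n x"
    have x: "x = encode_instance n ?d (?d n) (?d (n + 1))"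
      using encode_input_matrix[OF len valid] by simp
    have marking: "marking {..<n} (?d P)" for P
      using abs_input_matrix_le[of n x P] by (auto simp: marking_def abs_le_iff) (smt (verit))
    have "power_circuit {..<n} ?d \<and> real (pc_depth {..<n} ?d) \<le> C * log 2 (real n) \<and>
        rel (marking_eval {..<n} ?d (?d n)) (marking_eval {..<n} ?d (?d (n + 1)))"
      using dec main[OF x] marking by blast
    then show "x \<in> comparison_problem C rel"
      unfolding comparison_problem_def using x marking by blast
  qed
qed

end

text \<open>Lengths not of the form \<open>2 * n * (n + 2)\<close> carry no instance and get the
  empty disjunction, which rejects. From \<open>N = 2\<close> on, \<open>log 2 N\<close> is at least
  1 and can absorb additive constants.\<close>

lemma comparison_circuit:
  assumes C: "C > 0" and rel: "\<And>u v. rel u v \<longleftrightarrow> \<phi> (u < v) (v < u)"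
  shows "\<exists>c. circuit_wf N c \<and>
    (\<forall>x. length x = N \<longrightarrow> (x \<in> comparison_problem C rel \<longleftrightarrow> accepts c x)) \<and>
    (N \<ge> 2 \<longrightarrow> real (circuit_size c) \<le> (C + 5) * (24 * real N) ^ 537 \<and>
      real (circuit_depth c) \<le> (28 * C + 57) * log 2 (real N))"
proof (cases "\<exists>n. N = (n + 2) * (n * 2)")
  case True
  then obtain n where N: "N = (n + 2) * (n * 2)" by blast
  define X where "X = 4 * n + 20"
  obtain \<beta> where "X \<le> 2 ^ 2 ^ \<beta>" "2 ^ 2 ^ \<beta> \<le> X\<^sup>2"
    using exists_block_exponent[of X] unfolding X_def by auto
  then interpret block_length n \<beta> X
    using X_def by unfold_locales
  define h where "h = Suc (nat \<lfloor>C * log 2 (real n)\<rfloor>)"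
  obtain c where c: "circuit_wf N c" "\<forall>x. length x = N \<longrightarrow> accepts c x = decision n \<beta> h \<phi> x"
    and size: "circuit_size c \<le> N + h * X ^ 536 + X ^ 532 + 2"
    and depth: "circuit_depth c \<le> h * 28 + 29"
    using decision_circuit[of h \<phi>] unfolding N by blast
  have "x \<in> comparison_problem C rel \<longleftrightarrow> accepts c x" if "length x = N" for x
    using c(2) that comparison_problem_iff[of C rel \<phi> x] C rel unfolding N h_def by simp
  moreover have "real (circuit_size c) \<le> (C + 5) * (24 * real N) ^ 537 \<and>
      real (circuit_depth c) \<le> (28 * C + 57) * log 2 (real N)" if "N \<ge> 2"
  proof -
    have n: "n \<ge> 1" using that N by (cases n) auto
    have "n \<le> N" unfolding N by simp
    have "X \<le> 24 * N" using n \<open>n \<le> N\<close> unfolding X_def by linarith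
    define Y where "Y = 24 * real N"
    have Y: "real X \<le> Y" "Y \<ge> 1" "real N \<le> Y"
      using \<open>X \<le> 24 * N\<close> that unfolding Y_def by linarith+
    have log: "0 \<le> log 2 (real n)" "log 2 (real n) \<le> log 2 (real N)" "log 2 (real n) \<le> real n"
      using n \<open>n \<le> N\<close> log2_of_power_le[of n n] less_exp[of n] by auto
    have h: "real h \<le> C * log 2 (real n) + 1"
      using C log(1) by (simp add: h_def)
    also have "\<dots> \<le> C * real n + 1" using C log(3) by simp
    also have "\<dots> \<le> C * Y + Y" using C Y \<open>n \<le> N\<close> by (intro add_mono mult_left_mono) auto
    finally have hY: "real h \<le> (C + 1) * Y" by (simp add: algebra_simps)
    have pow: "Y ^ i \<le> Y ^ 537" if "i \<le> 537" for i
      using that Y(2) by (intro power_increasing)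
    have "real (h * X ^ 536) \<le> (C + 1) * Y * Y ^ 536"
      unfolding of_nat_mult of_nat_power using hY Y C by (intro mult_mono power_mono) auto
    also have "\<dots> = (C + 1) * Y ^ 537" by (simp flip: power_Suc)
    finally have 1: "real (h * X ^ 536) \<le> (C + 1) * Y ^ 537" .
    have "real (X ^ 532) \<le> Y ^ 532"
      unfolding of_nat_power using Y by (intro power_mono) auto
    then have 2: "real (X ^ 532) \<le> Y ^ 537" using pow[of 532] by linarith
    have 3: "real N \<le> Y ^ 537" "1 \<le> Y ^ 537" using pow[of 1] pow[of 0] Y by simp_all
    have "real (circuit_size c) \<le> real N + real (h * X ^ 536) + real (X ^ 532) + 2"
      using size by linarith
    \<comment> \<open>The factor collects \<open>C + 1\<close> from the layers, one each for
      \<open>N\<close> and \<open>X ^ 532\<close>, and two for the final summand.\<close>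
    also have "\<dots> \<le> (C + 5) * Y ^ 537"
      using 1 2 3 unfolding distrib_right by linarith
    finally have "real (circuit_size c) \<le> (C + 5) * Y ^ 537" .
    moreover have "real (circuit_depth c) \<le> (28 * C + 57) * log 2 (real N)"
    proof -
      have "real (circuit_depth c) \<le> real h * 28 + 29" using depth by linarith
      \<comment> \<open>Here \<open>57 = 28 + 29\<close>: the last of the \<open>h\<close> rounds
        contributes 28, the decision and the output gate 29.\<close>
      also have "\<dots> \<le> 28 * (C * log 2 (real n)) + 57" using h by linarith
      also have "\<dots> \<le> 28 * (C * log 2 (real N)) + 57 * log 2 (real N)"
      proof (intro add_mono mult_left_mono log)
        have "log 2 2 \<le> log 2 (real N)" using that by (subst log_le_cancel_iff) auto
        then show "57 \<le> 57 * log 2 (real N)" by simp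
      qed (use C in auto)
      finally show ?thesis by (simp add: algebra_simps)
    qed
    ultimately show ?thesis unfolding Y_def by blast
  qed
  ultimately show ?thesis using c(1) by blast
next
  case False
  have "x \<notin> comparison_problem C rel" if "length x = N" for x
    using False that unfolding comparison_problem_def by (auto simp: length_encode_instance)
  moreover have "\<not> accepts [Or_Gate []] x" for x
    by (simp add: accepts_def circuit_values_def)
  moreover have "circuit_wf N [Or_Gate []]" by (simp add: circuit_wf_def)
  moreover have "real (circuit_size [Or_Gate []]) \<le> (C + 5) * (24 * real N) ^ 537 \<and>
      real (circuit_depth [Or_Gate []]) \<le> (28 * C + 57) * log 2 (real N)" if "N \<ge> 2"
  proof -
    have "1 \<le> (24 * real N) ^ 537" using that by (intro one_le_power) linarith
    then have "1 * 1 \<le> (C + 5) * (24 * real N) ^ 537" using C by (intro mult_mono) auto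
    moreover have "log 2 2 \<le> log 2 (real N)" using that by (subst log_le_cancel_iff) auto
    then have "1 * 1 \<le> (28 * C + 57) * log 2 (real N)" using C by (intro mult_mono) auto
    ultimately show ?thesis by (simp add: circuit_size_def circuit_depth_def)
  qed
  ultimately show ?thesis by blast
qed

theorem propositionA:
  fixes C :: real and rel :: "real \<Rightarrow> real \<Rightarrow> bool"
  assumes "C > 0"
    and "rel \<in> {(=), (\<noteq>), (<), (\<le>), (>), (\<ge>)}"
  shows "comparison_problem C rel \<in> TC 1"
proof -
  \<comment> \<open>By trichotomy each of the six relations is a Boolean function of the two strict
    comparisons.\<close>
  have "\<exists>\<phi>. \<forall>u v. rel u v \<longleftrightarrow> \<phi> (u < v) (v < u)"
  proof -
    consider "rel = (=)" | "rel = (\<noteq>)" | "rel = (<)" | "rel = (\<le>)" | "rel = (>)" | "rel = (\<ge>)"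
      using assms(2) by blast
    then show ?thesis
    proof cases
      case 1 then show ?thesis by (intro exI[of _ "\<lambda>p q. \<not> p \<and> \<not> q"]) auto
    next
      case 2 then show ?thesis by (intro exI[of _ "\<lambda>p q. p \<or> q"]) auto
    next
      case 3 then show ?thesis by (intro exI[of _ "\<lambda>p q. p"]) auto
    next
      case 4 then show ?thesis by (intro exI[of _ "\<lambda>p q. \<not> q"]) auto
    next
      case 5 then show ?thesis by (intro exI[of _ "\<lambda>p q. q"]) auto
    next
      case 6 then show ?thesis by (intro exI[of _ "\<lambda>p q. \<not> p"]) auto
    qed
  qed
  then obtain \<phi> where \<phi>: "\<And>u v. rel u v \<longleftrightarrow> \<phi> (u < v) (v < u)" by blast
  obtain c where c: "\<And>N. circuit_wf N (c N)"
    "\<And>N x. length x = N \<Longrightarrow> x \<in> comparison_problem C rel \<longleftrightarrow> accepts (c N) x"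
    "\<And>N. N \<ge> 2 \<Longrightarrow> real (circuit_size (c N)) \<le> (C + 5) * (24 * real N) ^ 537"
    "\<And>N. N \<ge> 2 \<Longrightarrow> real (circuit_depth (c N)) \<le> (28 * C + 57) * log 2 (real N)"
    using comparison_circuit[where rel = rel and \<phi> = \<phi>, OF assms(1) \<phi>] by metis
  have "(\<lambda>N. real (circuit_size (c N))) \<in> O(\<lambda>N. real N ^ 537)"
  proof (rule bigoI)
    show "\<forall>\<^sub>F N in sequentially. norm (real (circuit_size (c N)))
        \<le> ((C + 5) * 24 ^ 537) * norm (real N ^ 537)"
      using eventually_ge_at_top[of 2]
    proof eventually_elim
      case (elim N)
      then show ?case using c(3)[OF elim] by (simp only: power_mult_distrib mult.assoc real_norm_def abs_of_nat abs_power_minus power_abs)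
    qed
  qed
  moreover have "(\<lambda>N. real (circuit_depth (c N))) \<in> O(\<lambda>N. log 2 (real N) ^ 1)"
  proof (rule bigoI)
    show "\<forall>\<^sub>F N in sequentially. norm (real (circuit_depth (c N)))
        \<le> (28 * C + 57) * norm (log 2 (real N) ^ 1)"
      using eventually_ge_at_top[of 2]
    proof eventually_elim
      case (elim N)
      then have "0 \<le> log 2 (real N)" by simp
      then show ?case using c(4)[OF elim] by simp
    qed
  qed
  ultimately show ?thesis unfolding TC_def using c(1,2) by blast
qed

end
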